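(* Let $S$ be a $C^1$-differentiable surface of $\ell^2$ with codimension $\Gamma_{\mathbb N\setminus I_0}$. Then there exists a unique Borel measure $\mu_S$ on $S$ such that, for every local coordinate triple $(S\cap U,I,f)$ of $S$ and every $E\in\mathscr B(S\cap U)$, $$\mu_S(E)=\int_{P_IE}n_I\bigl(\mathbf x_I+f(\mathbf x_I)\bigr)\,F_{\mathbb N\setminus I}\bigl(f(\mathbf x_I)\bigr)\,\mathrm d\mu_I(\mathbf x_I).$$
   Context: Basic notation. $\ell^2=\ell^2(\mathbb N)$ is the real Hilbert space with inner product $\langle\cdot,\cdot\rangle$ and standard orthonormal basis $\{\mathbf e_k\}_{k\ge1}$; $\mathbb N=\{1,2,\dots\}$, $\mathbb N_0=\mathbb N\cup\{0\}$. $\{a_i\}_{i\ge1}$ is a fixed sequence of positive numbers with $\sum_i a_i<\infty$. For $I\subset\mathbb N$, $P_I$ is the orthogonal projection of $\ell^2$ onto the closed linear span of $\{\mathbf e_i:i\in I\}$ ($P_\emptyset=0$). $C^1_X(U;Y)$ is the set of continuously Fréchet differentiable maps from an open subset $U$ of a normed space $X$ into a normed space $Y$. $\mathscr B(\cdot)$ is the Borel $\sigma$-algebra. Measures may take the value $+\infty$. Surfaces. For nonempty $I_1,I_2\subset\mathbb N$ write $I_1\sim I_2$ if $I_2=(I_1\setminus K_1)\sqcup K_2$ for some $K_1\subset I_1$, $K_2\subset\mathbb N\setminus I_1$ with $\mathrm{card}\,K_1=\mathrm{card}\,K_2\in\mathbb N_0$. Fix a nonempty $I_0\subset\mathbb N$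 and put $\Gamma_{I_0}=\{I\subset\mathbb N:I\sim I_0\}$. A nonempty $S\subset\ell^2$ is a surface with codimension $\Gamma_{\mathbb N\setminus I_0}$ if each $\mathbf x\in S$ has an open neighborhood $U$ in $\ell^2$, an $I\in\Gamma_{I_0}$, an open neighborhood $U_I$ of $P_I\mathbf x$ in $P_I\ell^2$ and $f\in C^1_{P_I\ell^2}(U_I;P_{\mathbb N\setminus I}\ell^2)$ such that $P_I|_{S\cap U}$ is a homeomorphism onto $U_I$ and $S\cap U=\{\mathbf y+f(\mathbf y):\mathbf y\in U_I\}$. Then $(S\cap U,I,f)$ is a local coordinate triple of $S$. A $C^1$-differentiable surface is such a surface with a family of local coordinate triples covering it. The quantity $n_I$. For a local coordinate triple $(S\cap U,I,f)$ and $\mathbf x\in S\cap U$, with $f_j=\langle f,\mathbf e_j\rangle$ and $\mathbf x_I=P_I\mathbf x$, $$n_I(\mathbf x)=\sqrt{1+\sum_{K_1\subset I,\,K_2\subset\mathbb N\setminus I,\,\mathrm{card}K_1=\mathrm{card}K_2\in\mathbb N}\bigl|\det(D_{x_i}f_j(\mathbf x_I))_{i\in K_1,j\in K_2}\bigr|^2}\in[1,\infty]$$ (elements of $K_1,K_2$ in increasing order). Gaussian data. $\mu_I$ is the Borel probability measure on $P_I\ell^2$ obtained by restricting the product measure $\prod_{i\in I}\frac{1}{\sqrt{2\pi a_i^2}}e^{-x_i^2/(2a_i^2)}\mathrm dx_i$. For $I\ne\emptyset$ let $C_I=\{\sum_{i\in I}x_i\mathbf e_i\in P_I\ell^2:\sum_{i\in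 I}|\ln\frac1{\sqrt{2\pi a_i^2}}-\frac{x_i^2}{2a_i^2}|<\infty\}$, and $F_I(\mathbf x_I)=\prod_{i\in I}\frac1{\sqrt{2\pi a_i^2}}e^{-x_i^2/(2a_i^2)}$ if $\mathbf x_I=\sum_{i\in I}x_i\mathbf e_i\in C_I$, $F_I(\mathbf x_I)=+\infty$ if $\mathbf x_I\in P_I\ell^2\setminus C_I$ (and $F_\emptyset\equiv1$). *)

theory Defs
  imports "HOL-Probability.Probability" "Jordan_Normal_Form.Determinant"
begin

text \<open>
  The index set of all sequences is \<^typ>\<open>nat\<close>, so that coordinates are numbered from 0.
\<close>

typedef ell2 = "{x :: nat \<Rightarrow> real. summable (\<lambda>i. (x i)\<^sup>2)}"
  morphisms coord Abs_ell2
  by (intro exI[of _ "\<lambda>_. 0"]) simp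

lemma summable_coord [simp]: "summable (\<lambda>i. (coord x i)\<^sup>2)"
  using coord[of x] by simp

lemma coord_Abs: "summable (\<lambda>i. (x i)\<^sup>2) \<Longrightarrow> coord (Abs_ell2 x) = x"
  by (simp add: Abs_ell2_inverse)

lemma ell2_eqI: "(\<And>i. coord x i = coord y i) \<Longrightarrow> x = y"
  by (metis coord_inject ext)

lemma summable_mult_squares:
  fixes x y :: "nat \<Rightarrow> real"
  assumes "summable (\<lambda>i. (x i)\<^sup>2)" "summable (\<lambda>i. (y i)\<^sup>2)"
  shows "summable (\<lambda>i. x i * y i)"
proof (rule summable_comparison_test')
  show "summable (\<lambda>i. (x i)\<^sup>2 + (y i)\<^sup>2)"
    by (intro summable_add assms)
  show "norm (x i * y i) \<le> (x i)\<^sup>2 + (y i)\<^sup>2" for i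
  proof -
    have "2 * (\<bar>x i\<bar> * \<bar>y i\<bar>) \<le> (x i)\<^sup>2 + (y i)\<^sup>2"
      using sum_squares_bound[of "\<bar>x i\<bar>" "\<bar>y i\<bar>"] by simp
    moreover have "0 \<le> \<bar>x i\<bar> * \<bar>y i\<bar>" by simp
    ultimately have "\<bar>x i\<bar> * \<bar>y i\<bar> \<le> (x i)\<^sup>2 + (y i)\<^sup>2" by linarith
    then show ?thesis by (simp add: abs_mult)
  qed
qed

lemma summable_add_squares:
  fixes x y :: "nat \<Rightarrow> real"
  assumes "summable (\<lambda>i. (x i)\<^sup>2)" "summable (\<lambda>i. (y i)\<^sup>2)"
  shows "summable (\<lambda>i. (x i + y i)\<^sup>2)"
  unfolding power2_sum mult.assoc
  by (intro summable_add summable_mult assms summable_mult_squares)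

lemma summable_scale_squares:
  fixes x :: "nat \<Rightarrow> real"
  assumes "summable (\<lambda>i. (x i)\<^sup>2)"
  shows "summable (\<lambda>i. (c * x i)\<^sup>2)"
  unfolding power_mult_distrib by (intro summable_mult assms)

instantiation ell2 :: real_inner
begin

definition zero_ell2 :: ell2 where "0 = Abs_ell2 (\<lambda>_. 0)"
definition plus_ell2 :: "ell2 \<Rightarrow> ell2 \<Rightarrow> ell2"
  where "x + y = Abs_ell2 (\<lambda>i. coord x i + coord y i)"
definition scaleR_ell2 :: "real \<Rightarrow> ell2 \<Rightarrow> ell2"
  where "c *\<^sub>R x = Abs_ell2 (\<lambda>i. c * coord x i)"
definition uminus_ell2 :: "ell2 \<Rightarrow> ell2" where "- x = (-1) *\<^sub>R (x :: ell2)"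
definition minus_ell2 :: "ell2 \<Rightarrow> ell2 \<Rightarrow> ell2" where "x - y = x + - (y :: ell2)"
definition inner_ell2 :: "ell2 \<Rightarrow> ell2 \<Rightarrow> real"
  where "inner x y = (\<Sum>i. coord x i * coord y i)"
definition norm_ell2 :: "ell2 \<Rightarrow> real" where "norm x = sqrt (inner x (x :: ell2))"
definition sgn_ell2 :: "ell2 \<Rightarrow> ell2" where "sgn x = inverse (norm x) *\<^sub>R (x :: ell2)"
definition dist_ell2 :: "ell2 \<Rightarrow> ell2 \<Rightarrow> real" where "dist x y = norm (x - y :: ell2)"
definition uniformity_ell2 :: "(ell2 \<times> ell2) filter"
  where "uniformity = (INF e\<in>{0<..}. principal {(x, y). dist x (y :: ell2) < e})"
definition open_ell2 :: "ell2 set \<Rightarrow> bool"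
  where "open U = (\<forall>x\<in>U. \<forall>\<^sub>F (x', y) in uniformity. x' = (x :: ell2) \<longrightarrow> y \<in> U)"

lemma coord_zero [simp]: "coord 0 i = 0"
  by (simp add: zero_ell2_def coord_Abs)
lemma coord_add [simp]: "coord (x + y) i = coord x i + coord y i"
  by (simp add: plus_ell2_def coord_Abs summable_add_squares)
lemma coord_scaleR [simp]: "coord (c *\<^sub>R x) i = c * coord x i"
  by (simp add: scaleR_ell2_def coord_Abs summable_scale_squares)
lemma coord_uminus [simp]: "coord (- x) i = - coord x i"
  by (simp add: uminus_ell2_def)
lemma coord_diff [simp]: "coord (x - y) i = coord x i - coord y i"
  by (simp add: minus_ell2_def)

lemma summable_coord_mult [simp]: "summable (\<lambda>i. coord x i * coord y i)"
  by (intro summable_mult_squares summable_coord)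

instance
proof
  fix x y z :: ell2 and r s :: real
  show "x + y + z = x + (y + z)" "x + y = y + x" "0 + x = x" "- x + x = 0" "x - y = x + - y"
    "r *\<^sub>R (x + y) = r *\<^sub>R x + r *\<^sub>R y" "(r + s) *\<^sub>R x = r *\<^sub>R x + s *\<^sub>R x"
    "r *\<^sub>R s *\<^sub>R x = (r * s) *\<^sub>R x" "1 *\<^sub>R x = x"
    by (rule ell2_eqI; simp add: algebra_simps)+
  show "dist x y = norm (x - y)" by (rule dist_ell2_def)
  show "sgn x = inverse (norm x) *\<^sub>R x" by (rule sgn_ell2_def)
  show "uniformity = (INF e\<in>{0<..}. principal {(x, y). dist x (y :: ell2) < e})"
    by (rule uniformity_ell2_def)
  show "open U = (\<forall>x\<in>U. \<forall>\<^sub>F (x', y) in uniformity. x' = x \<longrightarrow> y \<in> U)" for U :: "ell2 set"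
    by (rule open_ell2_def)
  show "inner x y = inner y x" by (simp add: inner_ell2_def mult.commute)
  show "inner (x + y) z = inner x z + inner y z"
    by (simp add: inner_ell2_def ring_distribs suminf_add)
  show "inner (r *\<^sub>R x) y = r * inner x y"
    by (simp add: inner_ell2_def mult.assoc suminf_mult)
  show "0 \<le> inner x x" by (simp add: inner_ell2_def suminf_nonneg)
  show "inner x x = 0 \<longleftrightarrow> x = 0"
  proof
    assume "inner x x = 0"
    then have "coord x i = 0" for i
      using suminf_eq_zero_iff[of "\<lambda>i. coord x i * coord x i"] by (simp add: inner_ell2_def)
    then show "x = 0" by (intro ell2_eqI) simp
  qed (simp add: inner_ell2_def)
  show "norm x = sqrt (inner x x)" by (rule norm_ell2_def)
qed

end

lemma norm_ell2_sq: "(norm x)\<^sup>2 = (\<Sum>i. (coord x i)\<^sup>2)"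
  unfolding power2_norm_eq_inner inner_ell2_def by (simp only: power2_eq_square)

lemma partial_sum_le_norm: "(\<Sum>i<n. (coord x i)\<^sup>2) \<le> (norm x)\<^sup>2"
  unfolding norm_ell2_sq by (intro sum_le_suminf) auto

lemma coord_le_norm: "\<bar>coord x i\<bar> \<le> norm x"
proof -
  have "(coord x i)\<^sup>2 \<le> (\<Sum>j<Suc i. (coord x j)\<^sup>2)"
    by (simp add: sum_nonneg)
  also note partial_sum_le_norm
  finally show ?thesis by (simp add: abs_le_square_iff[symmetric])
qed

instance ell2 :: complete_space
proof
  fix X :: "nat \<Rightarrow> ell2"
  assume X: "Cauchy X"
  have "Cauchy (\<lambda>n. coord (X n) i)" for i
  proof (rule metric_CauchyI)
    fix e :: real assume "0 < e"
    then obtain M where M: "\<And>m n. m \<ge> M \<Longrightarrow> n \<ge> M \<Longrightarrow> dist (X m) (X n) < e"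
      using metric_CauchyD[OF X] by blast
    show "\<exists>M. \<forall>m\<ge>M. \<forall>n\<ge>M. dist (coord (X m) i) (coord (X n) i) < e"
    proof (intro exI allI impI)
      fix m n assume "m \<ge> M" "n \<ge> M"
      from M[OF this] coord_le_norm[of "X m - X n" i]
      show "dist (coord (X m) i) (coord (X n) i) < e" by (simp add: dist_norm)
    qed
  qed
  then have "\<exists>l. \<forall>i. (\<lambda>n. coord (X n) i) \<longlonglongrightarrow> l i"
    by (intro choice allI) (simp add: Cauchy_convergent_iff convergent_def)
  then obtain l where l: "\<And>i. (\<lambda>n. coord (X n) i) \<longlonglongrightarrow> l i" by blast
  have tail: "\<exists>M. \<forall>n\<ge>M. \<forall>k. (\<Sum>i<k. (coord (X n) i - l i)\<^sup>2) \<le> e\<^sup>2" if "0 < e" for e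
  proof -
    from that obtain M where M: "\<And>m n. m \<ge> M \<Longrightarrow> n \<ge> M \<Longrightarrow> dist (X m) (X n) < e"
      using metric_CauchyD[OF X] by blast
    have "(\<Sum>i<k. (coord (X n) i - l i)\<^sup>2) \<le> e\<^sup>2" if n: "n \<ge> M" for n k
    proof (rule tendsto_upperbound)
      show "(\<lambda>m. \<Sum>i<k. (coord (X n) i - coord (X m) i)\<^sup>2) \<longlonglongrightarrow> (\<Sum>i<k. (coord (X n) i - l i)\<^sup>2)"
        by (intro tendsto_intros l)
      show "\<forall>\<^sub>F m in sequentially. (\<Sum>i<k. (coord (X n) i - coord (X m) i)\<^sup>2) \<le> e\<^sup>2"
        using eventually_ge_at_top[of M]
      proof eventually_elim
        case (elim m)
        have "(\<Sum>i<k. (coord (X n) i - coord (X m) i)\<^sup>2) \<le> (norm (X n - X m))\<^sup>2"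
          using partial_sum_le_norm[of "X n - X m" k] by simp
        also have "\<dots> \<le> e\<^sup>2"
          using M[OF n elim] by (intro power_mono) (auto simp: dist_norm)
        finally show ?case .
      qed
    qed simp
    then show ?thesis by blast
  qed
  have summ: "summable (\<lambda>i. (coord (X n) i - l i)\<^sup>2)"
    if "\<forall>k. (\<Sum>i<k. (coord (X n) i - l i)\<^sup>2) \<le> e\<^sup>2" for n e
    using that by (intro summableI_nonneg_bounded[where x = "e\<^sup>2"]) auto
  obtain M where M: "\<forall>k. (\<Sum>i<k. (coord (X M) i - l i)\<^sup>2) \<le> 1\<^sup>2"
    using tail[of 1] by auto
  have l_summable: "summable (\<lambda>i. (l i)\<^sup>2)"
    using summable_add_squares[OF summable_coord[of "X M"] summable_scale_squares[OF summ[OF M], of "-1"]]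
    by simp
  have "X \<longlonglongrightarrow> Abs_ell2 l"
  proof (rule metric_LIMSEQ_I)
    fix r :: real assume "0 < r"
    then obtain M where M: "\<And>n k. n \<ge> M \<Longrightarrow> (\<Sum>i<k. (coord (X n) i - l i)\<^sup>2) \<le> (r / 2)\<^sup>2"
      using tail[of "r / 2"] by auto
    have "dist (X n) (Abs_ell2 l) < r" if "n \<ge> M" for n
    proof -
      have "(norm (X n - Abs_ell2 l))\<^sup>2 = (\<Sum>i. (coord (X n) i - l i)\<^sup>2)"
        by (simp add: norm_ell2_sq coord_Abs l_summable)
      also have "\<dots> \<le> (r / 2)\<^sup>2"
        using M[OF that] by (intro suminf_le_const summ) auto
      finally have "norm (X n - Abs_ell2 l) \<le> r / 2"
        using \<open>0 < r\<close> by (simp add: abs_le_square_iff[symmetric])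
      then show ?thesis using \<open>0 < r\<close> by (simp add: dist_norm)
    qed
    then show "\<exists>M. \<forall>n\<ge>M. dist (X n) (Abs_ell2 l) < r" by blast
  qed
  then show "convergent X" by (auto simp: convergent_def)
qed

instance ell2 :: banach ..

definition unit_vec_ell2 :: "nat \<Rightarrow> ell2" (\<open>\<e>\<close>)
  where "\<e> k = Abs_ell2 (\<lambda>i. if i = k then 1 else 0)"

lemma coord_unit: "coord (\<e> k) i = (if i = k then 1 else 0)"
proof -
  have "summable (\<lambda>i. (if i = k then 1 else 0 :: real)\<^sup>2)"
    by (rule summable_finite[of "{k}"]) auto
  then show ?thesis by (simp add: unit_vec_ell2_def coord_Abs)
qed

lemma inner_unit: "inner x (\<e> k) = coord x k"
proof -
  have "(\<Sum>i. coord x i * (if i = k then 1 else 0)) = (\<Sum>i\<in>{k}. coord x i * (if i = k then 1 else 0))"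
    by (rule suminf_finite) auto
  then show ?thesis by (simp add: inner_ell2_def coord_unit)
qed

definition subspace_of :: "nat set \<Rightarrow> ell2 set"
  where "subspace_of I = closure (span (\<e> ` I))"

definition proj :: "nat set \<Rightarrow> ell2 \<Rightarrow> ell2"
  where "proj I x = (THE y. y \<in> subspace_of I \<and> (\<forall>z\<in>subspace_of I. inner (x - y) z = 0))"

lemma coord_restrict:
  "coord (Abs_ell2 (\<lambda>i. if i \<in> I then coord x i else 0)) i = (if i \<in> I then coord x i else 0)"
proof -
  have "summable (\<lambda>i. (if i \<in> I then coord x i else 0)\<^sup>2)"
    by (rule summable_comparison_test'[OF summable_coord[of x]]) auto
  then show ?thesis by (simp add: coord_Abs)
qed

lemma bounded_linear_coord: "bounded_linear (\<lambda>x. coord x i)"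
  by (rule bounded_linear_intro[where K = 1]) (auto simp: coord_le_norm)

lemma subspace_of_eq: "subspace_of I = {x. \<forall>i. i \<notin> I \<longrightarrow> coord x i = 0}"
proof
  have "closed {x. \<forall>i. i \<notin> I \<longrightarrow> coord x i = 0}"
  proof -
    have "closed {x. coord x i = 0}" for i
      by (intro closed_Collect_eq continuous_on_const
          linear_continuous_on[OF bounded_linear_coord])
    moreover have "{x. \<forall>i. i \<notin> I \<longrightarrow> coord x i = 0} = (\<Inter>i\<in>- I. {x. coord x i = 0})"
      by auto
    ultimately show ?thesis by auto
  qed
  moreover have "subspace {x. \<forall>i. i \<notin> I \<longrightarrow> coord x i = 0}"
    by (auto simp: subspace_def)
  ultimately show "subspace_of I \<subseteq> {x. \<forall>i. i \<notin> I \<longrightarrow> coord x i = 0}"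
    unfolding subspace_of_def
    by (intro closure_minimal span_minimal) (auto simp: coord_unit)
next
  show "{x. \<forall>i. i \<notin> I \<longrightarrow> coord x i = 0} \<subseteq> subspace_of I"
  proof
    fix x assume "x \<in> {x. \<forall>i. i \<notin> I \<longrightarrow> coord x i = 0}"
    then have x: "\<And>i. i \<notin> I \<Longrightarrow> coord x i = 0" by auto
    define X where "X n = (\<Sum>k<n. coord x k *\<^sub>R \<e> k)" for n
    have cX: "coord (X n) i = (if i < n then coord x i else 0)" for n i
    proof (induction n)
      case 0 then show ?case by (simp add: X_def)
    next
      case (Suc n)
      have "X (Suc n) = X n + coord x n *\<^sub>R \<e> n" by (simp add: X_def)
      then show ?case using Suc by (auto simp: coord_unit less_Suc_eq)
    qed
    have "X n \<in> span (\<e> ` I)" for n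
      unfolding X_def
    proof (rule span_sum)
      fix k show "coord x k *\<^sub>R \<e> k \<in> span (\<e> ` I)"
        using x[of k] by (cases "k \<in> I") (auto intro: span_scale span_base span_zero)
    qed
    moreover have "X \<longlonglongrightarrow> x"
    proof -
      have "(norm (X n - x))\<^sup>2 = (\<Sum>i. (coord x i)\<^sup>2) - (\<Sum>i<n. (coord x i)\<^sup>2)" for n
      proof -
        have "(norm (X n - x))\<^sup>2 = (\<Sum>i. (coord x i)\<^sup>2 - (if i < n then (coord x i)\<^sup>2 else 0))"
          unfolding norm_ell2_sq by (intro suminf_cong) (simp add: cX)
        also have "\<dots> = (\<Sum>i. (coord x i)\<^sup>2) - (\<Sum>i. if i < n then (coord x i)\<^sup>2 else 0)"
          by (rule suminf_diff[symmetric]) (auto intro!: summable_finite[of "{..<n}"])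
        also have "(\<Sum>i. if i < n then (coord x i)\<^sup>2 else 0) = (\<Sum>i<n. (coord x i)\<^sup>2)"
          by (subst suminf_finite[of "{..<n}"]) auto
        finally show ?thesis .
      qed
      moreover have "(\<lambda>n. (\<Sum>i. (coord x i)\<^sup>2) - (\<Sum>i<n. (coord x i)\<^sup>2)) \<longlonglongrightarrow> 0"
        using tendsto_diff[OF tendsto_const[of "\<Sum>i. (coord x i)\<^sup>2"]
            summable_LIMSEQ[OF summable_coord[of x]]]
        by simp
      ultimately have "(\<lambda>n. (norm (X n - x))\<^sup>2) \<longlonglongrightarrow> 0" by simp
      from tendsto_real_sqrt[OF this] have "(\<lambda>n. norm (X n - x)) \<longlonglongrightarrow> 0" by simp
      then show ?thesis by (subst LIM_zero_iff[symmetric]) (rule tendsto_norm_zero_cancel)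
    qed
    ultimately show "x \<in> subspace_of I"
      unfolding subspace_of_def closure_sequential by blast
  qed
qed

lemma coord_proj: "coord (proj I x) i = (if i \<in> I then coord x i else 0)"
proof -
  define p where "p = Abs_ell2 (\<lambda>i. if i \<in> I then coord x i else 0)"
  have cp: "coord p i = (if i \<in> I then coord x i else 0)" for i
    unfolding p_def by (rule coord_restrict)
  have "proj I x = p"
    unfolding proj_def
  proof (rule the_equality)
    show "p \<in> subspace_of I \<and> (\<forall>z\<in>subspace_of I. inner (x - p) z = 0)"
    proof (intro conjI ballI)
      show "p \<in> subspace_of I" by (simp add: subspace_of_eq cp)
      fix z assume "z \<in> subspace_of I"
      then have "coord (x - p) i * coord z i = 0" for i
        by (auto simp: subspace_of_eq cp)
      then show "inner (x - p) z = 0" unfolding inner_ell2_def by (simp only: suminf_zero)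
    qed
  next
    fix y assume y: "y \<in> subspace_of I \<and> (\<forall>z\<in>subspace_of I. inner (x - y) z = 0)"
    show "y = p"
    proof (rule ell2_eqI)
      fix i
      show "coord y i = coord p i"
      proof (cases "i \<in> I")
        case True
        then have "\<e> i \<in> subspace_of I" by (auto simp: subspace_of_eq coord_unit)
        with y have "inner (x - y) (\<e> i) = 0" by blast
        with True show ?thesis by (simp add: inner_unit cp)
      next
        case False
        with y show ?thesis by (simp add: subspace_of_eq cp)
      qed
    qed
  qed
  then show ?thesis by (simp add: cp)
qed

definition index_equiv :: "nat set \<Rightarrow> nat set \<Rightarrow> bool"
  where "index_equiv I1 I2 \<longleftrightarrow> I1 \<noteq> {} \<and> I2 \<noteq> {} \<and>
    (\<exists>K1 K2. K1 \<subseteq> I1 \<and> K2 \<subseteq> - I1 \<and> finite K1 \<and> finite K2 \<and> card K1 = card K2 \<and>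
      I2 = (I1 - K1) \<union> K2)"

definition index_class :: "nat set \<Rightarrow> nat set set"
  where "index_class I0 = {I. index_equiv I I0}"

text \<open>
  Continuously Frechet differentiable maps from a set \<open>U\<close>, open in the subspace \<open>X\<close>, to the
  subspace \<open>Y\<close>.  Only the values of \<open>f\<close> on \<open>U\<close> matter.  The derivative at a point of \<open>U\<close> is a
  bounded operator on \<open>X\<close>; here it is represented by a bounded operator on the whole
  space.  In a Hilbert space with closed \<open>X\<close> this changes nothing: composing with the orthogonal
  projection extends an operator on \<open>X\<close> without changing operator norms, while restricting to \<open>X\<close>
  does not increase them.
\<close>
definition C1_maps ::
  "'a::real_normed_vector set \<Rightarrow> 'a set \<Rightarrow> 'b::real_normed_vector set \<Rightarrow> ('a \<Rightarrow> 'b) set"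
  where "C1_maps X U Y = {f. openin (top_of_set X) U \<and> f ` U \<subseteq> Y \<and>
    (\<exists>D :: 'a \<Rightarrow> 'a \<Rightarrow>\<^sub>L 'b.
      (\<forall>x\<in>U. (f has_derivative blinfun_apply (D x)) (at x within U)) \<and> continuous_on U D)}"

text \<open>The set \<open>V\<close> is the piece \<open>S \<inter> U\<close> of the surface.\<close>
definition local_coordinate_triple ::
  "nat set \<Rightarrow> ell2 set \<Rightarrow> ell2 set \<Rightarrow> nat set \<Rightarrow> (ell2 \<Rightarrow> ell2) \<Rightarrow> bool"
  where "local_coordinate_triple I0 S V I f \<longleftrightarrow> V \<noteq> {} \<and> I \<in> index_class I0 \<and>
    (\<exists>U UI. open U \<and> V = S \<inter> U \<and>
      openin (top_of_set (subspace_of I)) UI \<and>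
      f \<in> C1_maps (subspace_of I) UI (subspace_of (- I)) \<and>
      (\<exists>g. homeomorphism V UI (proj I) g) \<and>
      V = {y + f y | y. y \<in> UI})"

definition surface_with_codim :: "nat set \<Rightarrow> ell2 set \<Rightarrow> bool"
  where "surface_with_codim I0 S \<longleftrightarrow> S \<noteq> {} \<and>
    (\<forall>x\<in>S. \<exists>V I f. x \<in> V \<and> local_coordinate_triple I0 S V I f)"

definition C1_differentiable_surface ::
  "nat set \<Rightarrow> ell2 set \<Rightarrow> (ell2 set \<times> nat set \<times> (ell2 \<Rightarrow> ell2)) set \<Rightarrow> bool"
  where "C1_differentiable_surface I0 S \<A> \<longleftrightarrow> surface_with_codim I0 S \<and>
    (\<forall>(V, I, f)\<in>\<A>. local_coordinate_triple I0 S V I f) \<and> (\<Union>(V, I, f)\<in>\<A>. V) = S"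

definition partial_deriv :: "(ell2 \<Rightarrow> ell2) \<Rightarrow> nat \<Rightarrow> nat \<Rightarrow> ell2 \<Rightarrow> real"
  where "partial_deriv f i j x = deriv (\<lambda>t. inner (f (x + t *\<^sub>R \<e> i)) (\<e> j)) 0"

definition minor :: "(ell2 \<Rightarrow> ell2) \<Rightarrow> ell2 \<Rightarrow> nat set \<Rightarrow> nat set \<Rightarrow> real"
  where "minor f x K1 K2 = Determinant.det (Matrix.mat (card K1) (card K2)
    (\<lambda>(r, c). partial_deriv f (sorted_list_of_set K1 ! r) (sorted_list_of_set K2 ! c) x))"

definition ennreal_sqrt :: "ennreal \<Rightarrow> ennreal"
  where "ennreal_sqrt t = (if t = \<infinity> then \<infinity> else ennreal (sqrt (enn2real t)))"

definition n_factor :: "nat set \<Rightarrow> (ell2 \<Rightarrow> ell2) \<Rightarrow> ell2 \<Rightarrow> ennreal"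
  where "n_factor I f x = ennreal_sqrt (1 +
    (\<Sum>\<^sub>\<infinity>(K1, K2)\<in>{(K1, K2). K1 \<subseteq> I \<and> K2 \<subseteq> - I \<and> finite K1 \<and> finite K2 \<and>
        card K1 = card K2 \<and> card K1 \<ge> 1}.
      ennreal (\<bar>minor f (proj I x) K1 K2\<bar>\<^sup>2)))"

text \<open>
  The product measure lives on real families indexed by \<open>I\<close>.  It is restricted to the square
  summable families, which are then identified with the elements of the subspace.
\<close>
definition gauss_measure :: "(nat \<Rightarrow> real) \<Rightarrow> nat set \<Rightarrow> ell2 measure"
  where "gauss_measure a I =
    distr
      (restrict_space (\<Pi>\<^sub>M i\<in>I. density lborel (\<lambda>x. ennreal (normal_density 0 (a i) x)))
        {x. (\<lambda>i. (x i)\<^sup>2) summable_on I})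
      (restrict_space borel (subspace_of I))
      (\<lambda>x. Abs_ell2 (\<lambda>i. if i \<in> I then x i else 0))"

definition C_set :: "(nat \<Rightarrow> real) \<Rightarrow> nat set \<Rightarrow> ell2 set"
  where "C_set a I = {x \<in> subspace_of I.
    (\<lambda>i. \<bar>ln (1 / sqrt (2 * pi * (a i)\<^sup>2)) - (coord x i)\<^sup>2 / (2 * (a i)\<^sup>2)\<bar>) summable_on I}"

text \<open>
  On \<open>C_set a I\<close> the logarithms of the factors are absolutely summable, so the product converges
  to a nonzero limit that does not depend on the order of the factors.
\<close>
definition F_density :: "(nat \<Rightarrow> real) \<Rightarrow> nat set \<Rightarrow> ell2 \<Rightarrow> ennreal"
  where "F_density a I x =
    (if I = {} then 1
     else if x \<in> C_set a I
       then ennreal (prodinf (\<lambda>i. if i \<in> I then normal_density 0 (a i) (coord x i) else 1))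
     else \<infinity>)"

end

theory Submission
  imports Defs
begin

text \<open>
  The right-hand side of the asserted formula is countably additive in \<open>E\<close> for each chart, so the only
  real issue is that two charts give the same value on their overlap; the measure is then glued from
  countably many charts, which suffice because \<open>\<ell>\<^sup>2\<close> is second countable, and it is unique for the same
  reason.

  Infinitely many coordinates do not enter the comparison of two charts.  If \<open>I\<close> and \<open>I'\<close> are the index
  sets of two charts, then \<open>I - I'\<close> and \<open>I' - I\<close> are finite and of equal size, and it is enough to
  exchange one index at a time: near a point \<open>p\<close> of the overlap and for \<open>i \<in> I - I'\<close> some partial
  derivative \<open>\<partial>\<^sub>i f\<^sub>j\<close> with \<open>j \<in> I' - I\<close> is nonzero, because otherwise the tangent vector in direction
  \<open>\<e> i\<close> would vanish in all coordinates from \<open>I'\<close>; the implicit function theorem in the single unknown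
  \<open>x\<^sub>i\<close> then yields a chart near \<open>p\<close> over \<open>I - {i} \<union> {j}\<close> (\<open>chart_exchange\<close>).  Induction on the size of
  \<open>I - I'\<close> leads from \<open>I\<close> to \<open>I'\<close>.

  For charts over \<open>J \<union> {i}\<close> and \<open>J \<union> {j}\<close> the transition map fixes the coordinates in \<open>J\<close>.  The Gaussian
  measure over \<open>J \<union> {i}\<close> is the product of the one over \<open>J\<close> and a normal distribution in \<open>x\<^sub>i\<close>
  (\<open>nn_integral_gauss_measure_insert\<close>), so for each fixed \<open>J\<close>-part there remains an injective change of
  variables on the real line, from \<open>x\<^sub>i\<close> to \<open>x\<^sub>j\<close>, with derivative \<open>d = \<partial>\<^sub>i f\<^sub>j\<close> (\<open>nn_integral_image_real\<close>).
  The normal density in \<open>x\<^sub>i\<close> times the factor \<open>F\<close> of the first chart equals the normal density in \<open>x\<^sub>j\<close>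
  times the factor \<open>F\<close> of the second: both are the product of the normal densities of all coordinates
  outside \<open>J\<close>.  It remains to see that \<open>n\<close> of the first chart is \<open>\<bar>d\<bar>\<close> times \<open>n\<close> of the second.

  For this, write \<open>n\<^sub>I\<^sup>2\<close> as the sum, over all \<open>L\<close> obtained from \<open>I\<close> by exchanging finitely many
  indices, of the squares of the Pluecker coordinates of the tangent space: the minors with rows
  \<open>I - L\<close> and columns \<open>L - I\<close> of the basis \<open>\<e> k + Df(\<e> k)\<close>, \<open>k \<in> I\<close> (\<open>n_factor_eq\<close>).  The index set of
  this sum is the same for both charts, and a change of the basis multiplies all Pluecker coordinates
  by one and the same determinant, which for a single exchange is \<open>d\<close> up to sign (\<open>minor_of_swap\<close>).
\<close>

section \<open>Minors up to sign\<close>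

text \<open>
  Only absolute values of minors enter, and these do not depend on the order in which rows and columns
  are listed.
\<close>

definition absdet :: "(nat \<Rightarrow> nat \<Rightarrow> real) \<Rightarrow> nat list \<Rightarrow> nat list \<Rightarrow> real"
  where "absdet m rs cs =
    \<bar>Determinant.det (Matrix.mat (length rs) (length rs) (\<lambda>(r, c). m (rs ! r) (cs ! c)))\<bar>"

lemma absdet_transpose:
  assumes "length rs = length cs"
  shows "absdet m rs cs = absdet (\<lambda>c r. m r c) cs rs"
proof -
  let ?A = "Matrix.mat (length rs) (length rs) (\<lambda>(r, c). m (rs ! r) (cs ! c))"
  have "transpose_mat ?A = Matrix.mat (length cs) (length cs) (\<lambda>(r, c). m (rs ! c) (cs ! r))"
    by (rule eq_matI) (auto simp: assms)
  moreover have "Determinant.det (transpose_mat ?A) = Determinant.det ?A"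
    by (rule Determinant.det_transpose[of _ "length rs"]) simp
  ultimately show ?thesis unfolding absdet_def by simp
qed

lemma absdet_permute_rows:
  assumes "mset rs = mset rs'"
  shows "absdet m rs cs = absdet m rs' cs"
proof -
  have len: "length rs = length rs'" using assms by (metis size_mset)
  obtain p where p: "p permutes {..<length rs'}" "permute_list p rs' = rs"
    using mset_eq_permutation[OF assms] by blast
  let ?n = "length rs'"
  let ?A = "Matrix.mat ?n ?n (\<lambda>(r, c). m (rs' ! r) (cs ! c))"
  have lt: "p r < ?n" if "r < ?n" for r
    using p(1) that by (metis lessThan_iff permutes_in_image)
  have "Matrix.mat ?n ?n (\<lambda>(r, c). m (rs ! r) (cs ! c)) = Matrix.mat ?n ?n (\<lambda>(r, c). ?A $$ (p r, c))"
    by (rule eq_matI) (use lt in \<open>auto simp: p(2)[symmetric] permute_list_nth[OF p(1)]\<close>)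
  moreover have "Determinant.det (Matrix.mat ?n ?n (\<lambda>(r, c). ?A $$ (p r, c))) = signof p * Determinant.det ?A"
    by (rule det_permute_rows) (use p(1) in \<open>auto simp: atLeast0LessThan\<close>)
  ultimately show ?thesis
    by (simp add: absdet_def len abs_mult sign_def)
qed

lemma absdet_permute:
  assumes "mset rs = mset rs'" "mset cs = mset cs'" "length rs = length cs"
  shows "absdet m rs cs = absdet m rs' cs'"
proof -
  have len: "length rs' = length cs" using assms by (metis size_mset)
  have "absdet m rs cs = absdet (\<lambda>c r. m r c) cs rs'"
    using absdet_permute_rows[OF assms(1)] absdet_transpose[OF len] by simp
  also have "\<dots> = absdet (\<lambda>c r. m r c) cs' rs'"
    by (rule absdet_permute_rows[OF assms(2)])
  also have "\<dots> = absdet m rs' cs'"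
    using len assms(2) by (intro absdet_transpose[symmetric]) (metis size_mset)
  finally show ?thesis .
qed

text \<open>
  Laplace expansion along a column with a single nonzero entry.
\<close>

lemma absdet_cons_col:
  assumes len: "length rs = length cs" and z: "\<And>r. r \<in> set rs \<Longrightarrow> m r c = 0"
  shows "absdet m (i # rs) (c # cs) = \<bar>m i c\<bar> * absdet m rs cs"
proof -
  let ?n = "length rs"
  let ?A = "Matrix.mat (Suc ?n) (Suc ?n) (\<lambda>(r, k). m ((i # rs) ! r) ((c # cs) ! k))"
  let ?A1 = "Matrix.mat 1 1 (\<lambda>_. m i c)"
  let ?A2 = "Matrix.mat 1 ?n (\<lambda>(_, k). m i (cs ! k))"
  let ?A4 = "Matrix.mat ?n ?n (\<lambda>(r, k). m (rs ! r) (cs ! k))"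
  have "?A = four_block_mat ?A1 ?A2 (0\<^sub>m ?n 1) ?A4"
    by (rule eq_matI) (auto simp: nth_Cons' z)
  also have "Determinant.det \<dots> = Determinant.det ?A1 * Determinant.det ?A4"
    by (rule det_four_block_mat_lower_left_zero[of _ 1 _ ?n]) auto
  also have "Determinant.det ?A1 = m i c"
    by (subst det_single) auto
  finally show ?thesis by (simp add: absdet_def abs_mult)
qed

text \<open>
  Multiplicativity of determinants, with the summation index running over the entries of a list instead
  of an initial segment of the natural numbers.
\<close>

lemma absdet_mult:
  assumes len: "length ks = length rs" and d: "distinct ks"
    and m: "\<And>r c. r \<in> set rs \<Longrightarrow> c \<in> set cs \<Longrightarrow> m r c = (\<Sum>k\<in>set ks. p r k * q k c)"
    and lc: "length cs = length rs"
  shows "absdet m rs cs = absdet p rs ks * absdet q ks cs"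
proof -
  let ?n = "length rs"
  let ?P = "Matrix.mat ?n ?n (\<lambda>(r, c). p (rs ! r) (ks ! c))"
  let ?Q = "Matrix.mat ?n ?n (\<lambda>(r, c). q (ks ! r) (cs ! c))"
  have "(\<Sum>k\<in>set ks. p r k * q k c) = (\<Sum>s<?n. p r (ks ! s) * q (ks ! s) c)" for r c
    using sum.reindex_bij_betw[OF bij_betw_nth[OF d refl refl], of "\<lambda>k. p r k * q k c"] len by simp
  then have "Matrix.mat ?n ?n (\<lambda>(r, c). m (rs ! r) (cs ! c)) = ?P * ?Q"
    by (intro eq_matI) (auto simp: m lc scalar_prod_def atLeast0LessThan)
  then have "Determinant.det (Matrix.mat ?n ?n (\<lambda>(r, c). m (rs ! r) (cs ! c)))
      = Determinant.det ?P * Determinant.det ?Q"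
    by (simp add: det_mult[of _ ?n])
  then show ?thesis by (simp add: absdet_def abs_mult len)
qed

lemma absdet_identity:
  assumes "distinct rs" "\<And>r c. r \<in> set rs \<Longrightarrow> c \<in> set rs \<Longrightarrow> m r c = (if r = c then 1 else 0)"
  shows "absdet m rs rs = 1"
proof -
  have "Matrix.mat (length rs) (length rs) (\<lambda>(r, c). m (rs ! r) (rs ! c)) = 1\<^sub>m (length rs)"
    by (rule eq_matI) (auto simp: assms nth_eq_iff_index_eq)
  then show ?thesis by (simp add: absdet_def)
qed

definition minor_of :: "(nat \<Rightarrow> nat \<Rightarrow> real) \<Rightarrow> nat set \<Rightarrow> nat set \<Rightarrow> real"
  where "minor_of m R C = absdet m (sorted_list_of_set R) (sorted_list_of_set C)"

lemma minor_of_eq: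
  assumes "distinct rs" "distinct cs" "length rs = length cs"
  shows "minor_of m (set rs) (set cs) = absdet m rs cs"
  unfolding minor_of_def
  by (rule absdet_permute)
    (use assms in \<open>auto simp: sorted_list_of_set_sort_remdups distinct_remdups_id\<close>)

lemma abs_minor:
  assumes "finite K1" "finite K2" "card K1 = card K2"
  shows "\<bar>minor f x K1 K2\<bar> = minor_of (\<lambda>i j. partial_deriv f i j x) K1 K2"
  using assms by (simp add: minor_def minor_of_def absdet_def)

lemma minor_of_cong:
  assumes "\<And>r c. r \<in> R \<Longrightarrow> c \<in> C \<Longrightarrow> m r c = m' r c" "finite R" "finite C" "card R = card C"
  shows "minor_of m R C = minor_of m' R C"
proof -
  have "Matrix.mat (card R) (card R)
      (\<lambda>(r, c). m (sorted_list_of_set R ! r) (sorted_list_of_set C ! c)) = Matrix.mat (card R) (card R)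
      (\<lambda>(r, c). m' (sorted_list_of_set R ! r) (sorted_list_of_set C ! c))"
  proof (rule eq_matI)
    fix r c assume "r < dim_row (Matrix.mat (card R) (card R)
      (\<lambda>(r, c). m' (sorted_list_of_set R ! r) (sorted_list_of_set C ! c)))"
     "c < dim_col (Matrix.mat (card R) (card R)
      (\<lambda>(r, c). m' (sorted_list_of_set R ! r) (sorted_list_of_set C ! c)))"
    then have rc: "r < card R" "c < card C" using assms by auto
    then have "sorted_list_of_set R ! r \<in> set (sorted_list_of_set R)"
         "sorted_list_of_set C ! c \<in> set (sorted_list_of_set C)"
      by (intro nth_mem; simp)+
    then show "Matrix.mat (card R) (card R)
      (\<lambda>(r, c). m (sorted_list_of_set R ! r) (sorted_list_of_set C ! c)) $$ (r, c) = Matrix.mat (card R) (card R)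
      (\<lambda>(r, c). m' (sorted_list_of_set R ! r) (sorted_list_of_set C ! c)) $$ (r, c)"
      using rc assms by auto
  qed auto
  then show ?thesis by (simp add: minor_of_def absdet_def)
qed

text \<open>
  If \<open>i \<in> L\<close>, then column \<open>i\<close> is a unit vector and may be added without changing the minor.  So
  both for \<open>i \<in> L\<close> and for \<open>i \<notin> L\<close> the minor is a determinant with the columns \<open>L - J\<close>, which do not
  depend on \<open>i\<close>.
\<close>

lemma minor_of_drop_unit:
  assumes "i \<notin> J" "finite (J - L)" "finite (L - J)" "card (L - J) = Suc (card (J - L))"
    and t: "\<And>k. k \<in> insert i J \<Longrightarrow> t k i = (if k = i then 1 else 0)"
    and rs: "set rs = J - L" "distinct rs" and cs: "set cs = L - J" "distinct cs"
  shows "minor_of t (insert i J - L) (L - insert i J) = absdet t (i # rs) cs"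
proof -
  have lrs: "length rs = card (J - L)" and lcs: "length cs = card (L - J)"
    using rs cs by (metis distinct_card)+
  show ?thesis
  proof (cases "i \<in> L")
    case True
    obtain cs' where cs': "set cs' = L - insert i J" "distinct cs'"
      using finite_distinct_list[of "L - insert i J"] assms(3) by (metis Diff_insert finite_Diff)
    have "set cs = set (i # cs')" "distinct (i # cs')" using True cs' cs assms(1) by auto
    then have ms: "mset cs = mset (i # cs')" using cs(2) set_eq_iff_mset_eq_distinct by blast
    have l: "length rs = length cs'" using ms lrs lcs assms(4) by (metis Suc_inject length_Cons size_mset)
    have "absdet t (i # rs) cs = absdet t (i # rs) (i # cs')"
      by (rule absdet_permute) (use ms l lcs lrs assms(4) in auto)
    also have "\<dots> = absdet t rs cs'"
      by (subst absdet_cons_col) (use l t rs assms(1) in auto)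
    also have "\<dots> = minor_of t (set rs) (set cs')"
      by (rule minor_of_eq[symmetric]) (use rs cs' l in auto)
    also have "set rs = insert i J - L" using True rs by auto
    finally show ?thesis by (simp add: cs')
  next
    case False
    have "absdet t (i # rs) cs = minor_of t (set (i # rs)) (set cs)"
      by (rule minor_of_eq[symmetric]) (use rs cs assms lrs lcs in auto)
    moreover have "set (i # rs) = insert i J - L" "set cs = L - insert i J"
      using False rs cs by auto
    ultimately show ?thesis by (simp only:)
  qed
qed

text \<open>
  The rows of \<open>t\<close> and \<open>u\<close> are two bases of one space, normalised on \<open>J \<union> {i}\<close> and on \<open>J \<union> {j}\<close>.  After
  both minors have been brought to the common set of columns \<open>L - J\<close>, the matrix of \<open>t\<close> is the transition
  matrix times the matrix of \<open>u\<close>; the transition matrix is triangular with diagonal entries \<open>t i j\<close> and 1.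
\<close>

lemma minor_of_swap:
  assumes ij: "i \<notin> J" "j \<notin> J" "i \<noteq> j"
    and L: "finite (insert i J - L)" "finite (L - insert i J)"
      "card (insert i J - L) = card (L - insert i J)"
    and t: "\<And>k l. k \<in> insert i J \<Longrightarrow> l \<in> insert i J \<Longrightarrow> t k l = (if k = l then 1 else 0)"
    and u: "\<And>k l. k \<in> insert j J \<Longrightarrow> l \<in> insert j J \<Longrightarrow> u k l = (if k = l then 1 else 0)"
    and ti: "\<And>l. t i l = t i j * u j l"
    and tk: "\<And>k l. k \<in> J \<Longrightarrow> t k l = u k l + t k j * u j l"
  shows "minor_of t (insert i J - L) (L - insert i J)
    = \<bar>t i j\<bar> * minor_of u (insert j J - L) (L - insert j J)"
proof -
  have fin: "finite (J - L)" "finite (L - J)"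
    using L by (auto intro: finite_subset[of _ "insert i (L - insert i J)"] finite_subset[of _ "insert i J - L"])
  have card: "card (L - J) = Suc (card (J - L))"
  proof (cases "i \<in> L")
    case True
    then have e: "insert i J - L = J - L" "L - J = insert i (L - insert i J)" using ij by auto
    have "card (insert i (L - insert i J)) = Suc (card (L - insert i J))"
      by (rule card_insert_disjoint) (use L in auto)
    then show ?thesis using L(3) unfolding e by (simp only:)
  next
    case False
    then have e: "insert i J - L = insert i (J - L)" "L - insert i J = L - J"
      using ij L by auto
    have "card (insert i (J - L)) = Suc (card (J - L))"
      by (rule card_insert_disjoint) (use fin ij in auto)
    then show ?thesis using L(3) unfolding e by simp
  qed
  obtain rs where rs: "set rs = J - L" "distinct rs" using finite_distinct_list[OF fin(1)] by auto
  obtain cs where cs: "set cs = L - J" "distinct cs" using finite_distinct_list[OF fin(2)] by auto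
  have lrs: "length rs = card (J - L)" and lcs: "length cs = card (L - J)"
    using rs cs by (metis distinct_card)+
  have dj: "distinct (j # rs)" using rs ij by auto
  have "minor_of t (insert i J - L) (L - insert i J) = absdet t (i # rs) cs"
    by (rule minor_of_drop_unit[OF ij(1) fin card _ rs cs]) (use t in auto)
  \<comment> \<open>The coefficients of a vector with respect to the basis \<open>u\<close> are its coordinates in \<open>J \<union> {j}\<close>.\<close>
  also have "\<dots> = absdet t (i # rs) (j # rs) * absdet u (j # rs) cs"
  proof (rule absdet_mult)
    fix r c assume r: "r \<in> set (i # rs)"
    show "t r c = (\<Sum>k\<in>set (j # rs). t r k * u k c)"
    proof (cases "r = i")
      case True
      have "(\<Sum>k\<in>set rs. t i k * u k c) = 0"
        by (rule sum.neutral) (use rs t ij in auto)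
      then show ?thesis using True dj ti[of c] by simp
    next
      case False
      then have rJ: "r \<in> set rs" "r \<in> J" using r rs by auto
      have "(\<Sum>k\<in>set rs. t r k * u k c) = (\<Sum>k\<in>set rs. if k = r then u k c else 0)"
        by (rule sum.cong) (use rs t rJ in auto)
      also have "\<dots> = u r c" using rJ by simp
      finally show ?thesis using tk[OF rJ(2), of c] dj by simp
    qed
  qed (use dj lrs lcs card in auto)
  also have "absdet t (i # rs) (j # rs) = \<bar>t i j\<bar>"
  proof -
    have "absdet t (i # rs) (j # rs) = absdet (\<lambda>c r. t r c) (j # rs) (i # rs)"
      by (rule absdet_transpose) simp
    also have "\<dots> = \<bar>t i j\<bar> * absdet (\<lambda>c r. t r c) rs rs"
      by (rule absdet_cons_col) (use rs t ij in auto)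
    also have "absdet (\<lambda>c r. t r c) rs rs = 1"
      by (rule absdet_identity) (use rs t in auto)
    finally show ?thesis by simp
  qed
  also have "absdet u (j # rs) cs = minor_of u (insert j J - L) (L - insert j J)"
    by (rule minor_of_drop_unit[OF ij(2) fin card _ rs cs, symmetric]) (use u in auto)
  finally show ?thesis .
qed

section \<open>Separability and coordinate projections\<close>

lemma norm_unit: "norm (\<e> k) = 1"
  by (simp add: norm_eq_sqrt_inner inner_unit coord_unit)

text \<open>
  Finite linear combinations of the unit vectors with rational coefficients are dense.
\<close>

lemma ell2_separable:
  "\<exists>D :: ell2 set. countable D \<and> (\<forall>x. \<forall>e>0. \<exists>d\<in>D. dist d x < e)"
proof (intro exI conjI allI impI)
  let ?q = "\<lambda>(A, rs). \<Sum>k\<in>A. real_of_rat (rs ! k) *\<^sub>R \<e> k"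
  let ?D = "?q ` ({A. finite A} \<times> UNIV)"
  show "countable ?D"
    by (intro countable_image countable_SIGMA countable_Collect_finite) auto
  fix x :: ell2 and e :: real assume e: "0 < e"
  have "x \<in> closure (span (range \<e>))"
    using subspace_of_eq[of UNIV] by (simp add: subspace_of_def)
  then obtain y where y: "y \<in> span (range \<e>)" "dist y x < e / 2"
    using e unfolding closure_approachable by (meson half_gt_zero)
  obtain T r where T: "finite T" "T \<subseteq> range \<e>" "y = (\<Sum>a\<in>T. r a *\<^sub>R a)"
    using y(1) unfolding span_explicit by blast
  obtain A where A: "inj_on \<e> A" "T = \<e> ` A" using T(2) by (auto simp: subset_image_inj)
  have fA: "finite A" using T(1) A finite_image_iff by blast
  have y_eq: "y = (\<Sum>k\<in>A. r (\<e> k) *\<^sub>R \<e> k)"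
    by (simp add: T(3) A sum.reindex)
  define d where "d = e / (2 * (card A + 1))"
  have d: "d > 0" using e by (simp add: d_def)
  have "\<forall>k. \<exists>q. \<bar>of_rat q - r (\<e> k)\<bar> < d"
  proof
    fix k
    obtain q where "r (\<e> k) < of_rat q" "of_rat q < r (\<e> k) + d"
      using of_rat_dense[of "r (\<e> k)" "r (\<e> k) + d"] d by auto
    then show "\<exists>q. \<bar>of_rat q - r (\<e> k)\<bar> < d" by (intro exI[of _ q]) auto
  qed
  then obtain q where q: "\<And>k. \<bar>of_rat (q k) - r (\<e> k)\<bar> < d" by metis
  obtain n where n: "A \<subseteq> {..<n}" using finite_nat_bounded[OF fA] by blast
  let ?z = "?q (A, map q [0..<n])"
  have z: "?z = (\<Sum>k\<in>A. real_of_rat (q k) *\<^sub>R \<e> k)"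
    by (auto intro!: sum.cong dest: subsetD[OF n])
  have "dist ?z y = norm (\<Sum>k\<in>A. (of_rat (q k) - r (\<e> k)) *\<^sub>R \<e> k)"
    unfolding z y_eq dist_norm by (simp add: sum_subtractf scaleR_diff_left)
  also have "\<dots> \<le> (\<Sum>k\<in>A. d)"
    by (intro order_trans[OF norm_sum] sum_mono) (use q in \<open>auto simp: norm_unit less_imp_le\<close>)
  also have "\<dots> < e / 2" using e by (simp add: d_def field_simps)
  finally have "dist ?z x < e" using y(2) dist_triangle[of ?z x y] by simp
  then show "\<exists>d\<in>?D. dist d x < e" using fA by (intro bexI[of _ ?z]) auto
qed

instance ell2 :: second_countable_topology
proof
  obtain D :: "ell2 set" where D: "countable D" "\<And>x e. e > 0 \<Longrightarrow> \<exists>d\<in>D. dist d x < e"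
    using ell2_separable by blast
  let ?B = "(\<lambda>(d, m). ball d (inverse (Suc m))) ` (D \<times> (UNIV :: nat set))"
  have "topological_basis ?B"
  proof (rule topological_basisI)
    fix U :: "ell2 set" and x assume U: "open U" "x \<in> U"
    obtain e where e: "e > 0" "ball x e \<subseteq> U" using U open_contains_ball by blast
    obtain m where m: "inverse (Suc m) < e / 2" using reals_Archimedean[of "e / 2"] e by auto
    obtain d where d: "d \<in> D" "dist d x < inverse (Suc m)" using D(2)[of "inverse (Suc m)"] by auto
    have "ball d (inverse (Suc m)) \<subseteq> ball x e"
    proof
      fix z assume "z \<in> ball d (inverse (Suc m))"
      then show "z \<in> ball x e"
        using dist_triangle[of x z d] d m by (simp add: dist_commute)
    qed
    then show "\<exists>B'\<in>?B. x \<in> B' \<and> B' \<subseteq> U"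
      using d e by (intro bexI[of _ "ball d (inverse (Suc m))"]) auto
  qed auto
  moreover have "countable ?B" using D(1) by (intro countable_image) auto
  ultimately show "\<exists>B :: ell2 set set. countable B \<and> open = generate_topology B"
    using topological_basis_imp_subbasis by blast
qed

lemma coord_sum: "coord (sum f A) i = (\<Sum>a\<in>A. coord (f a) i)"
  by (induction A rule: infinite_finite_induct) auto

lemma bounded_linear_proj: "bounded_linear (proj I)"
proof (rule bounded_linear_intro[where K = 1])
  fix x
  have "(norm (proj I x))\<^sup>2 \<le> (norm x)\<^sup>2"
    unfolding norm_ell2_sq
    by (intro suminf_le summable_coord) (auto simp: coord_proj)
  then show "norm (proj I x) \<le> norm x * 1" by (simp add: power2_le_iff_abs_le)
qed (auto intro!: ell2_eqI simp: coord_proj)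

lemma proj_in_subspace [simp]: "proj I x \<in> subspace_of I"
  by (simp add: subspace_of_eq coord_proj)

lemma proj_id: "x \<in> subspace_of I \<Longrightarrow> proj I x = x"
  by (rule ell2_eqI) (auto simp: coord_proj subspace_of_eq)

lemma proj_proj: "proj I (proj K x) = proj (I \<inter> K) x"
  by (rule ell2_eqI) (auto simp: coord_proj)

lemmas linear_proj = bounded_linear.linear[OF bounded_linear_proj]
lemmas proj_add = linear_add[OF linear_proj]
lemmas proj_scaleR = linear_cmul[OF linear_proj]
lemmas continuous_on_proj [continuous_intros] = bounded_linear.continuous_on[OF bounded_linear_proj]
lemmas continuous_on_coord [continuous_intros] = bounded_linear.continuous_on[OF bounded_linear_coord]

lemma proj_unit: "proj I (\<e> k) = (if k \<in> I then \<e> k else 0)"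
  by (rule ell2_eqI) (auto simp: coord_proj coord_unit)

section \<open>Charts and their tangent vectors\<close>

definition graph_map :: "nat set \<Rightarrow> (ell2 \<Rightarrow> ell2) \<Rightarrow> ell2 \<Rightarrow> ell2"
  where "graph_map I f x = proj I x + f (proj I x)"

text \<open>
  Working with \<open>f \<circ> proj I\<close> replaces maps on a relatively open subset of \<open>P\<^sub>I\<ell>\<^sup>2\<close> by maps on an open subset
  \<open>G\<close> of \<open>\<ell>\<^sup>2\<close> that is a union of fibres of \<open>proj I\<close>; derivatives are then ordinary derivatives at a
  point, and charts with different index sets are compared inside one space.
\<close>

definition chart :: "ell2 set \<Rightarrow> ell2 set \<Rightarrow> nat set \<Rightarrow> (ell2 \<Rightarrow> ell2) \<Rightarrow> ell2 set
    \<Rightarrow> (ell2 \<Rightarrow> ell2 \<Rightarrow>\<^sub>L ell2) \<Rightarrow> bool"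
  where "chart S U I f G D \<longleftrightarrow> open U \<and> open G \<and> (\<forall>x. proj I x \<in> G \<longleftrightarrow> x \<in> G) \<and>
    (\<forall>x\<in>G. f (proj I x) \<in> subspace_of (- I)) \<and>
    (\<forall>x\<in>G. ((\<lambda>z. f (proj I z)) has_derivative blinfun_apply (D x)) (at x)) \<and>
    continuous_on G D \<and> S \<inter> U = graph_map I f ` G"

lemma local_coordinate_triple_chart:
  assumes "local_coordinate_triple I0 S V I f"
  shows "\<exists>U G D. V = S \<inter> U \<and> chart S U I f G D"
proof -
  obtain U UI where U: "open U" "V = S \<inter> U" "openin (top_of_set (subspace_of I)) UI"
    "f \<in> C1_maps (subspace_of I) UI (subspace_of (- I))" "V = {y + f y | y. y \<in> UI}"
    using assms unfolding local_coordinate_triple_def by blast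
  obtain T where T: "open T" "UI = subspace_of I \<inter> T" using U(3) openin_open by metis
  obtain D :: "ell2 \<Rightarrow> ell2 \<Rightarrow>\<^sub>L ell2" where f: "f ` UI \<subseteq> subspace_of (- I)"
    and D: "\<And>x. x \<in> UI \<Longrightarrow> (f has_derivative blinfun_apply (D x)) (at x within UI)"
    "continuous_on UI D"
    using U(4) unfolding C1_maps_def by blast
  define G where "G = proj I -` T"
  have oG: "open G"
    unfolding G_def using continuous_on_proj[OF continuous_on_id] T(1)
    by (intro open_vimage) auto
  have GUI: "proj I x \<in> UI \<longleftrightarrow> x \<in> G" for x by (simp add: G_def T)
  have UIG: "UI \<subseteq> G" using GUI T(2) proj_id by fastforce
  let ?P = "Blinfun (proj I)"
  have P: "blinfun_apply ?P = proj I" by (rule bounded_linear_Blinfun_apply[OF bounded_linear_proj])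
  define D' where "D' x = D (proj I x) o\<^sub>L ?P" for x
  have "chart S U I f G D'"
    unfolding chart_def
  proof (intro conjI ballI allI U oG)
    show "proj I x \<in> G \<longleftrightarrow> x \<in> G" for x by (simp add: G_def proj_proj)
    show "f (proj I x) \<in> subspace_of (- I)" if "x \<in> G" for x using f GUI that by blast
    show "((\<lambda>z. f (proj I z)) has_derivative blinfun_apply (D' x)) (at x)" if x: "x \<in> G" for x
    proof -
      have "(f has_derivative blinfun_apply (D (proj I x))) (at (proj I x) within proj I ` G)"
        by (rule has_derivative_subset[OF D(1)]) (use GUI x in auto)
      moreover have "(proj I has_derivative proj I) (at x within G)"
        by (rule bounded_linear_imp_has_derivative[OF bounded_linear_proj])
      ultimately have "((\<lambda>z. f (proj I z)) has_derivative (\<lambda>v. D (proj I x) (proj I v))) (at x within G)"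
        by (rule has_derivative_in_compose[rotated])
      moreover have "blinfun_apply (D' x) = (\<lambda>v. D (proj I x) (proj I v))"
        by (auto simp: D'_def P)
      ultimately show ?thesis using at_within_open[OF x oG] by simp
    qed
    have "continuous_on G (\<lambda>x. D (proj I x))"
      by (rule continuous_on_compose2[OF D(2)]) (use GUI in \<open>auto intro!: continuous_intros\<close>)
    then show "continuous_on G D'" unfolding D'_def by (intro continuous_intros)
    have "V = graph_map I f ` G"
    proof safe
      fix p assume "p \<in> V"
      then obtain y where y: "p = y + f y" "y \<in> UI" using U(5) by auto
      moreover have "proj I y = y" using y T by (intro proj_id) auto
      ultimately show "p \<in> graph_map I f ` G"
        using UIG by (intro image_eqI[of _ _ y]) (auto simp: graph_map_def)
    next
      fix x assume "x \<in> G"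
      then show "graph_map I f x \<in> V" using GUI U(5) by (auto simp: graph_map_def)
    qed
    then show "S \<inter> U = graph_map I f ` G" using U(2) by simp
  qed
  then show ?thesis using U(2) by blast
qed

context
  fixes S U I f G D
  assumes chart: "chart S U I f G D"
begin

lemma chart_open: "open U" "open G"
  and chart_saturated: "proj I x \<in> G \<longleftrightarrow> x \<in> G"
  and chart_range: "x \<in> G \<Longrightarrow> f (proj I x) \<in> subspace_of (- I)"
  and chart_derivative:
    "x \<in> G \<Longrightarrow> ((\<lambda>z. f (proj I z)) has_derivative blinfun_apply (D x)) (at x)"
  and chart_derivative_continuous: "continuous_on G D"
  and chart_image: "S \<inter> U = graph_map I f ` G"
  using chart unfolding chart_def by blast+

lemma proj_graph_map: "x \<in> G \<Longrightarrow> proj I (graph_map I f x) = proj I x"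
  using chart_range[of x]
  by (intro ell2_eqI) (auto simp: coord_proj graph_map_def subspace_of_eq)

lemma graph_map_proj: "graph_map I f (proj I x) = graph_map I f x"
  by (simp add: graph_map_def proj_proj)

text \<open>
  The graph map only looks at the \<open>I\<close>-coordinates of its argument, and \<open>G\<close> is a union of fibres of
  \<open>proj I\<close>; so a point of the surface may serve as its own parameter.
\<close>

lemma chart_point:
  assumes "p \<in> S \<inter> U"
  shows "p \<in> G" "graph_map I f p = p"
proof -
  obtain x where x: "x \<in> G" "p = graph_map I f x" using assms chart_image by auto
  then have *: "proj I p = proj I x" using proj_graph_map by simp
  show "p \<in> G" using x * chart_saturated by metis
  show "graph_map I f p = p" using x * by (simp add: graph_map_def)
qed

lemma graph_map_in: "x \<in> G \<Longrightarrow> graph_map I f x \<in> S \<inter> U"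
  using chart_image by simp

lemma graph_map_derivative:
  "x \<in> G \<Longrightarrow> (graph_map I f has_derivative (\<lambda>v. proj I v + D x v)) (at x)"
  unfolding graph_map_def[abs_def]
  by (intro has_derivative_add chart_derivative
      bounded_linear_imp_has_derivative[OF bounded_linear_proj])

lemma continuous_on_graph_map: "continuous_on G (graph_map I f)"
  using graph_map_derivative
  by (meson chart_open(2) continuous_at_imp_continuous_on has_derivative_continuous)

lemma chart_derivative_proj:
  assumes "x \<in> G"
  shows "D (proj I x) (proj I v) = D x v"
proof -
  have "((\<lambda>z. f (proj I (proj I z))) has_derivative (\<lambda>v. D (proj I x) (proj I v))) (at x)"
    by (rule has_derivative_compose[OF bounded_linear_imp_has_derivative[OF bounded_linear_proj]
          chart_derivative]) (use assms chart_saturated in auto)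
  then have "((\<lambda>z. f (proj I z)) has_derivative (\<lambda>v. D (proj I x) (proj I v))) (at x)"
    by (simp add: proj_proj)
  from has_derivative_unique[OF this chart_derivative[OF assms]] show ?thesis by metis
qed

lemma chart_derivative_proj_arg: "x \<in> G \<Longrightarrow> D x (proj I v) = D x v"
  using chart_derivative_proj[of x v] chart_derivative_proj[of x "proj I v"] by (simp add: proj_proj)

lemma coord_chart_derivative:
  assumes "x \<in> G" "l \<in> I"
  shows "coord (D x v) l = 0"
proof -
  have 1: "((\<lambda>z. coord (f (proj I z)) l) has_derivative (\<lambda>v. coord (D x v) l)) (at x)"
    by (rule bounded_linear.has_derivative[OF bounded_linear_coord chart_derivative[OF assms(1)]])
  have 2: "((\<lambda>z. coord (f (proj I z)) l) has_derivative (\<lambda>_. 0)) (at x)"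
  proof (rule has_derivative_transform_within_open[OF has_derivative_const chart_open(2) assms(1)])
    show "0 = coord (f (proj I z)) l" if "z \<in> G" for z
      using chart_range[OF that] assms(2) by (auto simp: subspace_of_eq)
  qed
  from has_derivative_unique[OF 1 2] show ?thesis by metis
qed

lemma chart_coord_derivative_line:
  assumes "x \<in> G" "i \<in> I"
  shows "((\<lambda>s. coord (f (proj I (x + s *\<^sub>R \<e> i))) j) has_real_derivative coord (D x (\<e> i)) j) (at 0)"
proof -
  have "((\<lambda>s. x + s *\<^sub>R \<e> i) has_derivative (\<lambda>s. s *\<^sub>R \<e> i)) (at (0::real))"
    by (auto intro!: derivative_eq_intros)
  from has_derivative_compose[OF this, of "\<lambda>z. f (proj I z)" "D x"] chart_derivative[OF assms(1)]
  have "((\<lambda>s. f (proj I (x + s *\<^sub>R \<e> i))) has_derivative (\<lambda>s. D x (s *\<^sub>R \<e> i))) (at (0::real))"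
    by simp
  from bounded_linear.has_derivative[OF bounded_linear_coord this, of j]
  show ?thesis by (simp add: has_field_derivative_def blinfun.scaleR_right mult_commute_abs)
qed

lemma chart_partial_deriv:
  assumes "x \<in> G" "i \<in> I"
  shows "partial_deriv f i j (proj I x) = coord (D x (\<e> i)) j"
proof -
  have "proj I x \<in> G" using assms chart_saturated by simp
  from chart_coord_derivative_line[OF this assms(2), of j]
  have "((\<lambda>s. coord (f (proj I x + s *\<^sub>R \<e> i)) j) has_real_derivative coord (D (proj I x) (\<e> i)) j) (at 0)"
    using assms(2) by (simp add: proj_add proj_scaleR proj_unit proj_proj)
  moreover have "D (proj I x) (\<e> i) = D x (\<e> i)"
    using chart_derivative_proj[OF assms(1), of "\<e> i"] assms(2) by (simp add: proj_unit)
  ultimately show ?thesis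
    unfolding partial_deriv_def inner_unit using DERIV_imp_deriv by simp
qed

end

text \<open>
  On the overlap the two graph maps satisfy \<open>graph_map I' f' (graph_map I f z) = graph_map I f z\<close>.
  Differentiating at \<open>x\<close> shows that a tangent vector of the first chart is the tangent vector of the
  second chart over its own projection to \<open>I'\<close>.
\<close>

lemma chart_overlap_tangent:
  assumes c: "chart S U I f G D" and c': "chart S U' I' f' G' D'"
    and x: "x \<in> G" and p: "graph_map I f x = p" "p \<in> U'"
  shows "proj I v + D x v = proj I' (proj I v + D x v) + D' p (proj I v + D x v)"
proof -
  let ?H = "graph_map I f" and ?K = "graph_map I' f'"
  define W where "W = G \<inter> ?H -` U'"
  have W: "open W" "x \<in> W"
    unfolding W_def using continuous_open_preimage[OF continuous_on_graph_map[OF c]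
        chart_open(2)[OF c] chart_open(1)[OF c']] x p by auto
  have in': "?H z \<in> S \<inter> U'" if "z \<in> W" for z
    using that graph_map_in[OF c] by (auto simp: W_def)
  have pG: "p \<in> G'" using chart_point(1)[OF c' in'[OF W(2)]] p by simp
  have "(?K has_derivative (\<lambda>v. proj I' v + D' p v)) (at (?H x))"
    using graph_map_derivative[OF c' pG] p by simp
  from has_derivative_compose[OF graph_map_derivative[OF c x] this]
  have "((\<lambda>z. ?K (?H z)) has_derivative
      (\<lambda>v. proj I' (proj I v + D x v) + D' p (proj I v + D x v))) (at x)" .
  then have "(?H has_derivative
      (\<lambda>v. proj I' (proj I v + D x v) + D' p (proj I v + D x v))) (at x)"
    by (rule has_derivative_transform_within_open[OF _ W])
      (use chart_point(2)[OF c' in'] in auto)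
  from has_derivative_unique[OF graph_map_derivative[OF c x] this] show ?thesis by metis
qed

section \<open>Exchanging one coordinate of a chart\<close>

lemma isCont_tendsto_nhds: "isCont F y \<Longrightarrow> (F \<longlongrightarrow> F y) (nhds y)"
  by (simp add: isCont_def tendsto_at_iff_tendsto_nhds)

text \<open>
  The inverse function theorem for the map that replaces the coordinate \<open>x\<^sub>i\<close> by \<open>\<phi> x\<close>.  It changes one
  coordinate only, so monotonicity and the intermediate value theorem along the lines in direction
  \<open>\<e> i\<close> give injectivity and openness.  The factor \<open>c\<close> serves to treat increasing and decreasing
  \<open>\<phi>\<close> together.
\<close>

lemma coordinate_replacement_inverse:
  fixes \<phi> :: "ell2 \<Rightarrow> real" and L :: "ell2 \<Rightarrow> ell2 \<Rightarrow> real" and i :: nat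
  defines "g \<equiv> \<lambda>x. x + (\<phi> x - coord x i) *\<^sub>R \<e> i"
  assumes N: "open N" "convex N"
    and d: "\<And>x. x \<in> N \<Longrightarrow> (\<phi> has_derivative L x) (at x)"
    and c: "\<And>x. x \<in> N \<Longrightarrow> c * L x (\<e> i) > 0"
  shows "\<exists>h. open (g ` N) \<and> continuous_on (g ` N) h \<and> (\<forall>x\<in>N. h (g x) = x \<and>
    (h has_derivative (\<lambda>w. w + ((coord w i - L x w) / L x (\<e> i)) *\<^sub>R \<e> i)) (at (g x)))"
proof -
  have lin: "linear (L x)" "bounded_linear (L x)" if "x \<in> N" for x
    using d[OF that] has_derivative_linear has_derivative_bounded_linear by blast+
  have contphi: "continuous_on N \<phi>"
    using d N(1) by (meson continuous_at_imp_continuous_on has_derivative_continuous)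
  have seg: "x + s *\<^sub>R \<e> i \<in> N" if "x + p *\<^sub>R \<e> i \<in> N" "x + q *\<^sub>R \<e> i \<in> N" "p \<le> s" "s \<le> q" for x p q s
  proof (cases "p = q")
    case False
    then have pq: "p < q" using that by auto
    define u where "u = (s - p) / (q - p)"
    have "u * (q - p) = s - p" using pq by (simp add: u_def)
    then have "s = (1 - u) * p + u * q" by (simp only: left_diff_distrib right_diff_distrib mult_1)
    moreover have "0 \<le> u" "u \<le> 1" using that pq by (auto simp: u_def)
    ultimately have u: "0 \<le> u" "u \<le> 1" "s = (1 - u) * p + u * q" by blast+
    have "(1 - u) *\<^sub>R (x + p *\<^sub>R \<e> i) + u *\<^sub>R (x + q *\<^sub>R \<e> i) \<in> N"
      using N(2) that u by (auto simp: convex_alt)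
    moreover have "(1 - u) *\<^sub>R (x + p *\<^sub>R \<e> i) + u *\<^sub>R (x + q *\<^sub>R \<e> i) = x + s *\<^sub>R \<e> i"
      by (simp add: u(3) algebra_simps)
    ultimately show ?thesis by simp
  qed (use that in auto)
  have line: "((\<lambda>s. c * \<phi> (x + s *\<^sub>R \<e> i)) has_real_derivative c * L (x + s *\<^sub>R \<e> i) (\<e> i)) (at s)"
    if "x + s *\<^sub>R \<e> i \<in> N" for x s
  proof -
    have 1: "((\<lambda>s. x + s *\<^sub>R \<e> i) has_derivative (\<lambda>s. s *\<^sub>R \<e> i)) (at s)"
      by (auto intro!: derivative_eq_intros)
    have "((\<lambda>s. \<phi> (x + s *\<^sub>R \<e> i)) has_derivative (\<lambda>t. L (x + s *\<^sub>R \<e> i) (t *\<^sub>R \<e> i))) (at s)"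
      by (rule has_derivative_compose[OF 1 d[OF that]])
    then have "((\<lambda>s. c * \<phi> (x + s *\<^sub>R \<e> i)) has_derivative (\<lambda>t. c * L (x + s *\<^sub>R \<e> i) (t *\<^sub>R \<e> i))) (at s)"
      by (rule has_derivative_mult_right)
    then show ?thesis
      by (simp add: has_field_derivative_def linear_cmul[OF lin(1)[OF that]] mult_commute_abs mult.left_commute)
  qed
  have mono: "c * \<phi> (x + p *\<^sub>R \<e> i) < c * \<phi> (x + q *\<^sub>R \<e> i)"
    if "x + p *\<^sub>R \<e> i \<in> N" "x + q *\<^sub>R \<e> i \<in> N" "p < q" for x p q
  proof (rule DERIV_pos_imp_increasing[OF that(3)])
    fix s assume "p \<le> s" "s \<le> q"
    then have "x + s *\<^sub>R \<e> i \<in> N" using seg that by blast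
    then show "\<exists>y. ((\<lambda>s. c * \<phi> (x + s *\<^sub>R \<e> i)) has_real_derivative y) (at s) \<and> y > 0"
      using line c by blast
  qed
  have coordg: "coord (g x) k = (if k = i then \<phi> x else coord x k)" for x k
    by (simp add: g_def coord_unit)
  have inj: "inj_on g N"
  proof (rule inj_onI)
    fix x y assume xy: "x \<in> N" "y \<in> N" "g x = g y"
    then have *: "coord (g x) k = coord (g y) k" for k by simp
    define s where "s = coord y i - coord x i"
    have y: "y = x + s *\<^sub>R \<e> i"
    proof (rule ell2_eqI)
      fix k show "coord y k = coord (x + s *\<^sub>R \<e> i) k"
        using *[of k] by (auto simp: coordg coord_unit s_def split: if_splits)
    qed
    have "\<phi> x = \<phi> y" using *[of i] by (simp add: coordg)
    then have "\<not> s < 0" "\<not> 0 < s" using mono[of x s 0] mono[of x 0 s] xy y by auto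
    then show "x = y" using y by simp
  qed
  have open_map: "open (g ` N')" if N': "open N'" "N' \<subseteq> N" for N'
    unfolding open_subopen[of "g ` N'"]
  proof safe
    fix x assume x: "x \<in> N'"
    obtain r where r: "r > 0" "ball x r \<subseteq> N'" using N'(1) x open_contains_ball by blast
    define \<epsilon> where "\<epsilon> = r / 2"
    have eps: "0 < \<epsilon>" using r by (simp add: \<epsilon>_def)
    define A where "A s y = y + (coord x i + s - coord y i) *\<^sub>R \<e> i" for s y
    have Ag: "A s (g x) = x + s *\<^sub>R \<e> i" for s
      by (rule ell2_eqI) (simp add: A_def coordg coord_unit)
    have As: "A s y = A 0 y + s *\<^sub>R \<e> i" for s y
      by (rule ell2_eqI) (simp add: A_def coord_unit)
    have contA: "isCont (A s) y" for s y
      unfolding A_def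
      by (intro continuous_intros bounded_linear.isCont[OF bounded_linear_coord] continuous_ident)
    have in_ball: "x + s *\<^sub>R \<e> i \<in> N" if "\<bar>s\<bar> \<le> \<epsilon>" for s
    proof -
      have "x + s *\<^sub>R \<e> i \<in> ball x r" using that r by (simp add: dist_norm norm_unit \<epsilon>_def)
      then show ?thesis using r N' by blast
    qed
    have tend: "((\<lambda>y. c * \<phi> (A s y)) \<longlongrightarrow> c * \<phi> (x + s *\<^sub>R \<e> i)) (nhds (g x))" if "\<bar>s\<bar> \<le> \<epsilon>" for s
    proof -
      have "isCont \<phi> (A s (g x))"
        using in_ball[OF that] d has_derivative_continuous unfolding Ag by blast
      from isCont_o2[OF contA this] have "isCont (\<lambda>y. \<phi> (A s y)) (g x)" .
      then have "((\<lambda>y. \<phi> (A s y)) \<longlongrightarrow> \<phi> (A s (g x))) (nhds (g x))"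
        by (rule isCont_tendsto_nhds)
      then show ?thesis unfolding Ag by (intro tendsto_intros)
    qed
    have tc: "((\<lambda>y. c * coord y i) \<longlongrightarrow> c * coord (g x) i) (nhds (g x))"
      by (intro tendsto_intros isCont_tendsto_nhds
          bounded_linear.isCont[OF bounded_linear_coord continuous_ident])
    have up: "c * coord (g x) i < c * \<phi> (x + \<epsilon> *\<^sub>R \<e> i)"
      using mono[of x 0 \<epsilon>] in_ball[of 0] in_ball[of \<epsilon>] eps by (simp add: coordg)
    have lo: "c * \<phi> (x + (-\<epsilon>) *\<^sub>R \<e> i) < c * coord (g x) i"
      using mono[of x "-\<epsilon>" 0] in_ball[of 0] in_ball[of "-\<epsilon>"] eps by (simp add: coordg)
    have ev1: "\<forall>\<^sub>F y in nhds (g x). c * coord y i < c * \<phi> (A \<epsilon> y)"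
      using order_tendstoD(1)[OF tendsto_diff[OF tend[of \<epsilon>] tc], of 0] up eps by simp
    have ev2: "\<forall>\<^sub>F y in nhds (g x). c * \<phi> (A (-\<epsilon>) y) < c * coord y i"
      using order_tendstoD(1)[OF tendsto_diff[OF tc tend[of "-\<epsilon>"]], of 0] lo eps by simp
    have ev3: "\<forall>\<^sub>F y in nhds (g x). dist (A 0 y) x < \<epsilon>"
    proof -
      have "(A 0 \<longlongrightarrow> A 0 (g x)) (nhds (g x))" by (rule isCont_tendsto_nhds[OF contA])
      from tendstoD[OF this eps] show ?thesis by (simp add: Ag)
    qed
    obtain T where T: "open T" "g x \<in> T" and TT: "\<And>y. y \<in> T \<Longrightarrow> c * coord y i < c * \<phi> (A \<epsilon> y)
        \<and> c * \<phi> (A (-\<epsilon>) y) < c * coord y i \<and> dist (A 0 y) x < \<epsilon>"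
      using eventually_conj[OF ev1 eventually_conj[OF ev2 ev3]] unfolding eventually_nhds by blast
    have "T \<subseteq> g ` N'"
    proof
      fix y assume "y \<in> T"
      note y = TT[OF this]
      have AN: "A s y \<in> N'" if "\<bar>s\<bar> \<le> \<epsilon>" for s
      proof -
        have "dist (A s y) (A 0 y) \<le> \<epsilon>"
          unfolding As[of s] using that by (simp add: dist_norm norm_unit)
        then have "dist x (A s y) < r"
          using y dist_triangle[of x "A s y" "A 0 y"] by (simp add: \<epsilon>_def dist_commute)
        then show ?thesis using r by auto
      qed
      have "\<exists>s\<ge>-\<epsilon>. s \<le> \<epsilon> \<and> c * \<phi> (A s y) = c * coord y i"
      proof (rule IVT)
        show "\<forall>s. -\<epsilon> \<le> s \<and> s \<le> \<epsilon> \<longrightarrow> isCont (\<lambda>s. c * \<phi> (A s y)) s"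
        proof (intro allI impI)
          fix s assume "-\<epsilon> \<le> s \<and> s \<le> \<epsilon>"
          then have "A 0 y + s *\<^sub>R \<e> i \<in> N" using AN[of s] N'(2) unfolding As[of s] by auto
          from DERIV_isCont[OF line[OF this]] show "isCont (\<lambda>s. c * \<phi> (A s y)) s"
            by (simp add: As[symmetric])
        qed
      qed (use y eps in \<open>auto intro: less_imp_le\<close>)
      then obtain s where "s \<ge> -\<epsilon>" "s \<le> \<epsilon>" "c * \<phi> (A s y) = c * coord y i" by blast
      then have s: "\<bar>s\<bar> \<le> \<epsilon>" "c * \<phi> (A s y) = c * coord y i" by (simp_all add: abs_le_iff)
      have "c \<noteq> 0" using c[of x] x N' by auto
      then have "\<phi> (A s y) = coord y i" using s by simp
      then have "g (A s y) = y"
        by (intro ell2_eqI) (auto simp: coordg A_def coord_unit)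
      then show "y \<in> g ` N'" using AN[OF s(1)] by (metis imageI)
    qed
    then show "\<exists>T. open T \<and> g x \<in> T \<and> T \<subseteq> g ` N'" using T by blast
  qed
  define h where "h = inv_into N g"
  have hg: "h (g x) = x" if "x \<in> N" for x using inj that by (simp add: h_def)
  have ogN: "open (g ` N)" by (rule open_map) (use N in auto)
  have contg: "continuous_on N g"
    unfolding g_def by (intro continuous_intros contphi)
  have conth: "continuous_on (g ` N) h"
  proof (rule continuous_on_inverse_open_map[OF contg refl hg])
    fix V assume "openin (top_of_set N) V"
    then have "open V" "V \<subseteq> N" using N(1) openin_open_eq by auto
    then show "openin (top_of_set (g ` N)) (g ` V)"
      using open_map ogN by (simp add: openin_open_eq image_mono)
  qed
  moreover have "(h has_derivative (\<lambda>w. w + ((coord w i - L x w) / L x (\<e> i)) *\<^sub>R \<e> i)) (at (g x))"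
    if x: "x \<in> N" for x
  proof (rule has_derivative_inverse_basic[where T = "g ` N" and f = g])
    show "(g has_derivative (\<lambda>v. v + (L x v - coord v i) *\<^sub>R \<e> i)) (at (h (g x)))"
      unfolding hg[OF x] unfolding g_def
      by (intro has_derivative_add has_derivative_ident has_derivative_scaleR_left has_derivative_diff
          d[OF x] bounded_linear_imp_has_derivative[OF bounded_linear_coord])
    show "bounded_linear (\<lambda>w. w + ((coord w i - L x w) / L x (\<e> i)) *\<^sub>R \<e> i)"
      by (intro bounded_linear_add bounded_linear_ident bounded_linear_scaleR_left[THEN bounded_linear_compose]
          bounded_linear_divide[THEN bounded_linear_compose] bounded_linear_sub
          bounded_linear_coord lin(2)[OF x])
    show "(\<lambda>w. w + ((coord w i - L x w) / L x (\<e> i)) *\<^sub>R \<e> i) \<circ> (\<lambda>v. v + (L x v - coord v i) *\<^sub>R \<e> i) = id"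
    proof
      fix v
      have "L x (\<e> i) \<noteq> 0" using c[OF x] by auto
      moreover have "L x (v + (L x v - coord v i) *\<^sub>R \<e> i) = L x v + (L x v - coord v i) * L x (\<e> i)"
        by (simp add: linear_add[OF lin(1)[OF x]] linear_cmul[OF lin(1)[OF x]])
      ultimately show "((\<lambda>w. w + ((coord w i - L x w) / L x (\<e> i)) *\<^sub>R \<e> i) \<circ> (\<lambda>v. v + (L x v - coord v i) *\<^sub>R \<e> i)) v = id v"
        by (simp add: coord_unit scaleR_add_left[symmetric])
    qed
    show "isCont h (g x)" using conth ogN x by (simp add: continuous_on_eq_continuous_at)
    show "g (h z) = z" if "z \<in> g ` N" for z using that hg by auto
  qed (use ogN x in auto)
  ultimately show ?thesis using ogN hg by blast
qed


text \<open>
  The equation \<open>f\<^sub>j = y\<^sub>j\<close> is solved for \<open>x\<^sub>i\<close>: \<open>\<sigma> y\<close> is the old parameter of the point with the new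
  parameter \<open>y\<close>, obtained by applying the inverse of the coordinate replacement to \<open>\<iota> y\<close>, which stores
  the given value \<open>y\<^sub>j\<close> of \<open>f\<^sub>j\<close> as \<open>i\<close>-th coordinate.
\<close>

lemma chart_exchange:
  assumes c: "chart S U (insert i J) f G D" and ij: "i \<notin> J" "j \<notin> J" "i \<noteq> j"
    and x1: "x1 \<in> G" "coord (D x1 (\<e> i)) j \<noteq> 0"
  shows "\<exists>U' f' G' D'. chart S U' (insert j J) f' G' D' \<and> graph_map (insert i J) f x1 \<in> U'"
proof -
  let ?I = "insert i J" and ?I' = "insert j J"
  define x0 where "x0 = proj ?I x1"
  have x0: "x0 \<in> G" "proj ?I x0 = x0" "coord (D x0 (\<e> i)) j \<noteq> 0"
    using x1 chart_saturated[OF c] chart_derivative_proj[OF c x1(1), of "\<e> i"]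
    by (simp_all add: x0_def proj_proj proj_unit)
  define \<phi> where "\<phi> x = coord (f (proj ?I x)) j" for x
  define L where "L x v = coord (D x v) j" for x v
  \<comment> \<open>The sign of \<open>k\<close> is the sign of \<open>\<partial>\<^sub>i f\<^sub>j\<close> near \<open>x0\<close>.\<close>
  define k where "k = L x0 (\<e> i)"
  define g where "g x = x + (\<phi> x - coord x i) *\<^sub>R \<e> i" for x
  have contL: "continuous_on G (\<lambda>x. k * L x (\<e> i))"
    unfolding L_def by (intro continuous_intros chart_derivative_continuous[OF c])
  have "open (G \<inter> (\<lambda>x. k * L x (\<e> i)) -` {0<..})"
    by (rule continuous_open_preimage[OF contL chart_open(2)[OF c]]) simp
  moreover have "x0 \<in> G \<inter> (\<lambda>x. k * L x (\<e> i)) -` {0<..}"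
    using x0 by (auto simp: k_def L_def zero_less_mult_iff linorder_neq_iff)
  ultimately obtain r where r: "r > 0" "ball x0 r \<subseteq> G \<inter> (\<lambda>x. k * L x (\<e> i)) -` {0<..}"
    unfolding open_contains_ball by blast
  define N where "N = ball x0 r"
  have N: "open N" "convex N" "x0 \<in> N" "N \<subseteq> G" "\<And>x. x \<in> N \<Longrightarrow> k * L x (\<e> i) > 0"
    using r by (auto simp: N_def)
  have der: "(\<phi> has_derivative L x) (at x)" if "x \<in> N" for x
    unfolding \<phi>_def[abs_def] L_def[abs_def]
    by (rule bounded_linear.has_derivative[OF bounded_linear_coord chart_derivative[OF c]])
      (use that N in auto)
  obtain h where h: "open (g ` N)" "continuous_on (g ` N) h" "\<And>x. x \<in> N \<Longrightarrow> h (g x) = x"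
    "\<And>x. x \<in> N \<Longrightarrow> (h has_derivative (\<lambda>w. w + ((coord w i - L x w) / L x (\<e> i)) *\<^sub>R \<e> i)) (at (g x))"
    using coordinate_replacement_inverse[OF N(1,2) der N(5)] unfolding g_def by blast
  have coordg: "coord (g x) l = (if l = i then \<phi> x else coord x l)" for x l
    by (simp add: g_def coord_unit)
  define \<iota> where "\<iota> y = proj J y + coord y j *\<^sub>R \<e> i" for y
  have bl_iota: "bounded_linear \<iota>"
    unfolding \<iota>_def[abs_def]
    by (intro bounded_linear_add bounded_linear_proj bounded_linear_scaleR_left[THEN bounded_linear_compose]
        bounded_linear_coord)
  have coord_iota: "coord (\<iota> y) l = (if l = i then coord y j else if l \<in> J then coord y l else 0)" for y l
    using ij by (auto simp: \<iota>_def coord_proj coord_unit)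
  have cont_iota: "continuous_on A \<iota>" for A
    by (rule bounded_linear.continuous_on[OF bl_iota continuous_on_id])
  define \<sigma> where "\<sigma> y = h (\<iota> y)" for y
  define G' where "G' = \<iota> -` (g ` N)"
  define U' where "U' = U \<inter> proj ?I -` N"
  \<comment> \<open>The same point of the surface, of which the new parameter is subtracted.\<close>
  define f' where "f' y = graph_map ?I f (\<sigma> y) - proj ?I' y" for y
  have iota_proj: "\<iota> (proj ?I' y) = \<iota> y" for y
    by (rule ell2_eqI) (auto simp: coord_iota coord_proj)
  have f'_proj: "f' (proj ?I' y) = graph_map ?I f (\<sigma> y) - proj ?I' y" for y
    by (simp add: f'_def \<sigma>_def iota_proj proj_proj)
  have graph': "graph_map ?I' f' y = graph_map ?I f (\<sigma> y)" for y
    by (simp add: graph_map_def[of ?I' f'] f'_proj)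
  have sigma: "\<sigma> y \<in> N" "g (\<sigma> y) = \<iota> y" if "y \<in> G'" for y
    using that h(3) by (auto simp: G'_def \<sigma>_def)
  have sigma_coord: "\<phi> (\<sigma> y) = coord y j"
    "l \<in> J \<Longrightarrow> coord (\<sigma> y) l = coord y l" "l \<notin> ?I \<Longrightarrow> coord (\<sigma> y) l = 0" if "y \<in> G'" for y l
    using sigma(2)[OF that, THEN arg_cong, of "\<lambda>z. coord z i"]
      sigma(2)[OF that, THEN arg_cong, of "\<lambda>z. coord z l"] ij
    by (auto simp: coordg coord_iota split: if_splits)
  have proj_sigma: "proj ?I (\<sigma> y) = \<sigma> y" if "y \<in> G'" for y
    using sigma_coord(3)[OF that] by (intro proj_id) (simp add: subspace_of_eq)
  have oU': "open U'"
    unfolding U'_def using chart_open(1)[OF c] N(1) continuous_on_proj[OF continuous_on_id]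
    by (intro open_Int open_vimage)
  have oG': "open G'" unfolding G'_def using h(1) cont_iota by (intro open_vimage)
  \<comment> \<open>A point of the surface close to the given one is recovered from its new coordinates.\<close>
  have point: "p \<in> G'" "\<sigma> p = proj ?I p" if "p \<in> S \<inter> U'" for p
  proof -
    have p: "p \<in> S \<inter> U" "proj ?I p \<in> N" using that by (auto simp: U'_def)
    have "proj ?I p + f (proj ?I p) = p"
      using chart_point(2)[OF c p(1)] by (simp add: graph_map_def)
    from arg_cong[OF this, of "\<lambda>z. coord z j"] have "coord (f (proj ?I p)) j = coord p j"
      using ij by (simp add: coord_proj)
    then have "g (proj ?I p) = \<iota> p"
      using ij by (intro ell2_eqI) (auto simp: coordg coord_iota coord_proj \<phi>_def proj_proj)
    then show "p \<in> G'" "\<sigma> p = proj ?I p"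
      using p(2) h(3)[OF p(2)] by (auto simp: G'_def \<sigma>_def intro!: image_eqI)
  qed
  let ?P = "\<lambda>I. Blinfun (proj I)" and ?C = "\<lambda>l. Blinfun (\<lambda>v. coord v l)" and ?i = "Blinfun \<iota>"
  have P: "blinfun_apply (?P I) = proj I" for I
    by (rule bounded_linear_Blinfun_apply[OF bounded_linear_proj])
  have C: "blinfun_apply (?C l) = (\<lambda>v. coord v l)" for l
    by (rule bounded_linear_Blinfun_apply[OF bounded_linear_coord])
  have i: "blinfun_apply ?i = \<iota>" by (rule bounded_linear_Blinfun_apply[OF bl_iota])
  \<comment> \<open>The derivative of \<open>f'\<close>, composed of bounded operators so that its continuity in \<open>y\<close> can be read off.\<close>
  define D' where "D' y = ((?P ?I + D (\<sigma> y)) o\<^sub>L (id_blinfun + inverse (L (\<sigma> y) (\<e> i)) *\<^sub>R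
      (blinfun_scaleR_left (\<e> i) o\<^sub>L (?C i - (?C j o\<^sub>L D (\<sigma> y))))) o\<^sub>L ?i) - ?P ?I'" for y
  have "chart S U' ?I' f' G' D'"
    unfolding chart_def
  proof (intro conjI ballI allI oU' oG')
    show "proj ?I' y \<in> G' \<longleftrightarrow> y \<in> G'" for y by (simp add: G'_def iota_proj)
    show "f' (proj ?I' y) \<in> subspace_of (- ?I')" if y: "y \<in> G'" for y
      unfolding subspace_of_eq
    proof (intro CollectI allI impI)
      fix l assume l: "l \<notin> - ?I'"
      have "coord (f' (proj ?I' y)) l = coord (\<sigma> y) l + coord (f (proj ?I (\<sigma> y))) l - coord y l"
        using l unfolding f'_proj by (simp add: graph_map_def proj_sigma[OF y] coord_proj)
      also have "\<dots> = 0"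
      proof (cases "l = j")
        case True
        then show ?thesis using sigma_coord(1,3)[OF y] ij by (simp add: \<phi>_def)
      next
        case False
        then have "l \<in> J" using l by auto
        moreover have "f (proj ?I (\<sigma> y)) \<in> subspace_of (- ?I)"
          by (rule chart_range[OF c]) (use sigma[OF y] N in auto)
        ultimately show ?thesis using sigma_coord(2)[OF y] by (simp add: subspace_of_eq)
      qed
      finally show "coord (f' (proj ?I' y)) l = 0" .
    qed
    show "((\<lambda>z. f' (proj ?I' z)) has_derivative blinfun_apply (D' y)) (at y)" if y: "y \<in> G'" for y
    proof -
      note s = sigma[OF y]
      have "(h has_derivative (\<lambda>w. w + ((coord w i - L (\<sigma> y) w) / L (\<sigma> y) (\<e> i)) *\<^sub>R \<e> i)) (at (\<iota> y))"
        using h(4)[OF s(1)] s(2) by simp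
      from has_derivative_compose[OF bounded_linear_imp_has_derivative[OF bl_iota] this]
      have 1: "(\<sigma> has_derivative
          (\<lambda>v. \<iota> v + ((coord (\<iota> v) i - L (\<sigma> y) (\<iota> v)) / L (\<sigma> y) (\<e> i)) *\<^sub>R \<e> i)) (at y)"
        unfolding \<sigma>_def[abs_def] .
      have 2: "(graph_map ?I f has_derivative (\<lambda>v. proj ?I v + D (\<sigma> y) v)) (at (\<sigma> y))"
        by (rule graph_map_derivative[OF c]) (use s N in auto)
      have 3: "blinfun_apply (D' y) = (\<lambda>v.
          proj ?I (\<iota> v + ((coord (\<iota> v) i - L (\<sigma> y) (\<iota> v)) / L (\<sigma> y) (\<e> i)) *\<^sub>R \<e> i)
          + D (\<sigma> y) (\<iota> v + ((coord (\<iota> v) i - L (\<sigma> y) (\<iota> v)) / L (\<sigma> y) (\<e> i)) *\<^sub>R \<e> i)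
          - proj ?I' v)"
        by (rule ext) (simp add: D'_def P C i L_def blinfun.diff_left blinfun.add_left
            blinfun.scaleR_left divide_inverse mult.commute)
      show ?thesis
        unfolding f'_proj 3
        by (intro has_derivative_diff has_derivative_compose[OF 1 2]
            bounded_linear_imp_has_derivative[OF bounded_linear_proj])
    qed
    have cs: "continuous_on G' \<sigma>"
      unfolding \<sigma>_def[abs_def]
      by (rule continuous_on_compose2[OF h(2) cont_iota]) (auto simp: G'_def)
    have cD: "continuous_on G' (\<lambda>y. D (\<sigma> y))"
      by (rule continuous_on_compose2[OF chart_derivative_continuous[OF c] cs])
        (use sigma N in auto)
    have "L (\<sigma> y) (\<e> i) \<noteq> 0" if "y \<in> G'" for y
      using N(5)[OF sigma(1)[OF that]] by auto
    then show "continuous_on G' D'"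
      unfolding D'_def L_def by (intro continuous_intros cD) auto
    show "S \<inter> U' = graph_map ?I' f' ` G'"
    proof safe
      fix p assume p: "p \<in> S" "p \<in> U'"
      then have "graph_map ?I' f' p = p"
        using point[of p] chart_point(2)[OF c, of p] graph_map_proj[OF c, of p]
        by (simp add: graph' U'_def)
      then show "p \<in> graph_map ?I' f' ` G'" using point[of p] p by (metis IntI imageI)
    next
      fix y assume y: "y \<in> G'"
      then have "\<sigma> y \<in> G" using sigma N by auto
      then have "graph_map ?I f (\<sigma> y) \<in> S \<inter> U"
        "proj ?I (graph_map ?I f (\<sigma> y)) = \<sigma> y"
        using graph_map_in[OF c] proj_graph_map[OF c] proj_sigma[OF y] by auto
      then show "graph_map ?I' f' y \<in> S" "graph_map ?I' f' y \<in> U'"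
        using sigma[OF y] by (auto simp: graph' U'_def)
    qed
  qed
  moreover have "graph_map ?I f x1 \<in> U'"
    using graph_map_in[OF c x1(1)] proj_graph_map[OF c x1(1)] N(3) by (simp add: U'_def x0_def)
  ultimately show ?thesis by blast
qed

section \<open>The factor of the tangent space and the density of the normal directions\<close>

definition finite_swaps :: "nat set \<Rightarrow> nat set set"
  where "finite_swaps I = {L. finite (I - L) \<and> finite (L - I) \<and> card (I - L) = card (L - I)}"

text \<open>
  Turns the equality of the sizes of the two differences into an equality \<open>card (A \<inter> M) = card (B \<inter> M)\<close>,
  which is visibly transitive once \<open>M\<close> is large enough for all sets involved.
\<close>

lemma card_Diff_eq_iff:
  fixes A B :: "nat set"
  assumes "finite M" "A - B \<subseteq> M" "B - A \<subseteq> M"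
  shows "card (A - B) = card (B - A) \<longleftrightarrow> card (A \<inter> M) = card (B \<inter> M)"
proof -
  have "card (A \<inter> M) = card (A \<inter> B \<inter> M) + card (A - B)"
    using assms by (subst card_Un_disjoint[symmetric]) (auto intro: finite_subset arg_cong[of _ _ card])
  moreover have "card (B \<inter> M) = card (A \<inter> B \<inter> M) + card (B - A)"
    using assms by (subst card_Un_disjoint[symmetric]) (auto intro: finite_subset arg_cong[of _ _ card])
  ultimately show ?thesis by simp
qed

lemma finite_swaps_refl: "I \<in> finite_swaps I"
  by (simp add: finite_swaps_def)

lemma finite_swaps_sym: "L \<in> finite_swaps I \<Longrightarrow> I \<in> finite_swaps L"
  by (auto simp: finite_swaps_def)

lemma finite_swaps_trans:
  assumes "L \<in> finite_swaps I" "I' \<in> finite_swaps I"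
  shows "L \<in> finite_swaps I'"
proof -
  let ?M = "(I - L) \<union> (L - I) \<union> (I - I') \<union> (I' - I)"
  have M: "finite ?M" using assms by (auto simp: finite_swaps_def)
  have "card (I \<inter> ?M) = card (L \<inter> ?M)" "card (I \<inter> ?M) = card (I' \<inter> ?M)"
    using assms by (subst card_Diff_eq_iff[OF M, symmetric]; auto simp: finite_swaps_def)+
  then have "card (I' - L) = card (L - I')"
    by (subst card_Diff_eq_iff[OF M]) auto
  moreover have "finite (I' - L)" "finite (L - I')"
    by (rule finite_subset[OF _ M]; auto)+
  ultimately show ?thesis by (simp add: finite_swaps_def)
qed

lemma finite_swaps_eq: "I' \<in> finite_swaps I \<Longrightarrow> finite_swaps I' = finite_swaps I"
  using finite_swaps_trans finite_swaps_sym by blast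

lemma finite_swaps_insert:
  assumes "i \<notin> J" "j \<notin> J"
  shows "insert j J \<in> finite_swaps (insert i J)"
proof (cases "i = j")
  case False
  then have "insert i J - insert j J = {i}" "insert j J - insert i J = {j}" using assms by auto
  then show ?thesis by (simp only: finite_swaps_def mem_Collect_eq) simp
qed (simp add: finite_swaps_refl)

lemma countable_finite_swaps: "countable (finite_swaps I)"
proof -
  have "finite_swaps I \<subseteq> (\<lambda>(A, B). (I - A) \<union> B) ` ({A. finite A} \<times> {B. finite B})"
  proof
    fix L assume "L \<in> finite_swaps I"
    then show "L \<in> (\<lambda>(A, B). (I - A) \<union> B) ` ({A. finite A} \<times> {B. finite B})"
      by (intro image_eqI[of _ _ "(I - L, L - I)"]) (auto simp: finite_swaps_def)
  qed
  then show ?thesis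
    by (rule countable_subset) (intro countable_image countable_SIGMA countable_Collect_finite)
qed

lemma index_class_finite_swaps:
  assumes "I \<in> index_class I0" "I' \<in> index_class I0"
  shows "I' \<in> finite_swaps I"
proof -
  have *: "I0 \<in> finite_swaps I" if I: "I \<in> index_class I0" for I
  proof -
    obtain K1 K2 where K: "K1 \<subseteq> I" "K2 \<subseteq> - I" "finite K1" "finite K2" "card K1 = card K2"
      "I0 = (I - K1) \<union> K2"
      using I unfolding index_class_def index_equiv_def by blast
    then have "I - I0 = K1" "I0 - I = K2" by auto
    then show ?thesis using K by (simp add: finite_swaps_def)
  qed
  show ?thesis using *[OF assms(1)] *[OF assms(2)] finite_swaps_sym finite_swaps_trans by blast
qed

lemma infsum_ennreal_eq_SUP:
  "infsum f A = (SUP F\<in>{F. finite F \<and> F \<subseteq> A}. sum f F :: ennreal)"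
  by (rule nonneg_infsum_complete) simp

lemma infsum_cmult_ennreal:
  "(\<Sum>\<^sub>\<infinity>x\<in>A. c * f x :: ennreal) = c * (\<Sum>\<^sub>\<infinity>x\<in>A. f x)"
proof -
  have "{F. finite F \<and> F \<subseteq> A} \<noteq> {}" by blast
  then show ?thesis
    unfolding infsum_ennreal_eq_SUP sum_distrib_left[symmetric]
    by (simp add: SUP_mult_left_ennreal)
qed

lemma borel_measurable_infsum_ennreal:
  fixes f :: "'i \<Rightarrow> 'a \<Rightarrow> ennreal"
  assumes "countable A" "\<And>i. i \<in> A \<Longrightarrow> f i \<in> borel_measurable M"
  shows "(\<lambda>x. \<Sum>\<^sub>\<infinity>i\<in>A. f i x) \<in> borel_measurable M"
  unfolding infsum_ennreal_eq_SUP
  by (intro borel_measurable_SUP borel_measurable_sum countable_Collect_finite_subset assms) auto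

lemma borel_measurable_det:
  fixes m :: "'a \<Rightarrow> nat \<Rightarrow> nat \<Rightarrow> real"
  assumes "\<And>r c. (\<lambda>x. m x r c) \<in> borel_measurable M"
  shows "(\<lambda>x. Determinant.det (Matrix.mat n n (\<lambda>(r, c). m x r c))) \<in> borel_measurable M"
proof -
  have *: "Determinant.det (Matrix.mat n n (\<lambda>(r, c). m x r c))
      = (\<Sum>p | p permutes {0..<n}. signof p * (\<Prod>r = 0..<n. m x r (p r)))" for x
  proof -
    have "p r < n" if "p permutes {0..<n}" "r < n" for p r
      using permutes_in_image[OF that(1), of r] that(2) by simp
    then show ?thesis
      by (auto simp: Determinant.det_def intro!: sum.cong arg_cong2[of _ _ _ _ times] prod.cong)
  qed
  show ?thesis
    unfolding *
    by (intro borel_measurable_sum borel_measurable_times borel_measurable_const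
        borel_measurable_prod assms)
qed

lemma ennreal_sqrt_scale:
  assumes "d > 0"
  shows "ennreal_sqrt (ennreal (d\<^sup>2) * s) = ennreal d * ennreal_sqrt s"
proof (cases s)
  case (real r)
  then show ?thesis using assms
    by (simp add: ennreal_sqrt_def ennreal_mult'[symmetric] real_sqrt_mult ennreal_mult''[symmetric])
next
  case top
  then show ?thesis using assms by (simp add: ennreal_sqrt_def ennreal_mult_top)
qed

text \<open>
  For the derivative \<open>A\<close> of a chart over \<open>I\<close>, the vectors \<open>\<e> k + A (\<e> k)\<close> with \<open>k \<in> I\<close> are its
  tangent basis.
\<close>

definition tangent_coord :: "(ell2 \<Rightarrow>\<^sub>L ell2) \<Rightarrow> nat \<Rightarrow> nat \<Rightarrow> real"
  where "tangent_coord A k l = coord (\<e> k + A (\<e> k)) l"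

text \<open>
  A pair \<open>(K\<^sub>1, K\<^sub>2)\<close> corresponds to \<open>L = (I - K\<^sub>1) \<union> K\<^sub>2\<close>, so that \<open>K\<^sub>1 = I - L\<close> and \<open>K\<^sub>2 = L - I\<close>; the
  summand 1 is the empty minor, which belongs to \<open>L = I\<close>.  The pairs depend on \<open>I\<close>, whereas the
  collection of all \<open>L\<close> is the same for all index sets of charts of one surface.
\<close>

lemma n_factor_eq:
  assumes c: "chart S U I f G D" and x: "x \<in> G"
  shows "n_factor I f (graph_map I f x) = ennreal_sqrt
    (\<Sum>\<^sub>\<infinity>L\<in>finite_swaps I. ennreal ((minor_of (tangent_coord (D x)) (I - L) (L - I))\<^sup>2))"
proof -
  let ?T = "\<lambda>L. ennreal ((minor_of (tangent_coord (D x)) (I - L) (L - I))\<^sup>2)"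
  let ?K = "{(K1, K2). K1 \<subseteq> I \<and> K2 \<subseteq> - I \<and> finite K1 \<and> finite K2 \<and>
        card K1 = card K2 \<and> card K1 \<ge> 1}"
  have bij: "bij_betw (\<lambda>L. (I - L, L - I)) (finite_swaps I - {I}) ?K"
  proof (rule bij_betw_byWitness[where f' = "\<lambda>(K1, K2). (I - K1) \<union> K2"])
    show "(\<lambda>L. (I - L, L - I)) ` (finite_swaps I - {I}) \<subseteq> ?K"
    proof (rule image_subsetI)
      fix L assume "L \<in> finite_swaps I - {I}"
      then have L: "L \<in> finite_swaps I" "L \<noteq> I" by auto
      have "card (I - L) \<noteq> 0"
      proof
        assume "card (I - L) = 0"
        then have "I - L = {}" "L - I = {}" using L(1) by (auto simp: finite_swaps_def)
        then show False using L(2) by blast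
      qed
      then show "(I - L, L - I) \<in> ?K" using L(1) by (auto simp: finite_swaps_def Suc_le_eq)
    qed
    show "(\<lambda>(K1, K2). (I - K1) \<union> K2) ` ?K \<subseteq> finite_swaps I - {I}"
    proof (rule image_subsetI)
      fix K assume "K \<in> ?K"
      then obtain K1 K2 where K: "K = (K1, K2)" "K1 \<subseteq> I" "K2 \<subseteq> - I" "finite K1" "finite K2"
        "card K1 = card K2" "1 \<le> card K1" by auto
      then have *: "I - (I - K1 \<union> K2) = K1" "(I - K1 \<union> K2) - I = K2" by auto
      have "I - K1 \<union> K2 \<in> finite_swaps I" unfolding finite_swaps_def using K by (simp add: *)
      moreover have "I - K1 \<union> K2 \<noteq> I" using * K by (metis Diff_cancel card.empty not_one_le_zero)
      ultimately show "(\<lambda>(K1, K2). (I - K1) \<union> K2) K \<in> finite_swaps I - {I}" using K(1) by simp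
    qed
  qed auto
  have minor_eq: "ennreal (\<bar>minor f (proj I (graph_map I f x)) K1 K2\<bar>\<^sup>2)
      = ennreal ((minor_of (tangent_coord (D x)) K1 K2)\<^sup>2)"
    if "K1 \<subseteq> I" "K2 \<subseteq> - I" "finite K1" "finite K2" "card K1 = card K2" for K1 K2
  proof -
    have "minor_of (\<lambda>i j. partial_deriv f i j (proj I x)) K1 K2 = minor_of (tangent_coord (D x)) K1 K2"
      using that chart_partial_deriv[OF c x]
      by (intro minor_of_cong) (auto simp: tangent_coord_def coord_unit)
    then show ?thesis using abs_minor[OF that(3-5)] proj_graph_map[OF c x] by simp
  qed
  have "(\<Sum>\<^sub>\<infinity>(K1, K2)\<in>?K. ennreal (\<bar>minor f (proj I (graph_map I f x)) K1 K2\<bar>\<^sup>2))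
      = (\<Sum>\<^sub>\<infinity>L\<in>finite_swaps I - {I}. ?T L)"
    unfolding infsum_reindex_bij_betw[OF bij, symmetric] prod.case
    by (rule infsum_cong, rule minor_eq) (auto simp: finite_swaps_def)
  moreover have "?T I = 1" by (simp add: minor_of_def absdet_def)
  moreover have "(\<Sum>\<^sub>\<infinity>L\<in>{I} \<union> (finite_swaps I - {I}). ?T L)
      = (\<Sum>\<^sub>\<infinity>L\<in>{I}. ?T L) + (\<Sum>\<^sub>\<infinity>L\<in>finite_swaps I - {I}. ?T L)"
    by (intro infsumI has_sum_Un_disjoint has_sum_infsum nonneg_summable_on_complete) auto
  moreover have "{I} \<union> (finite_swaps I - {I}) = finite_swaps I" using finite_swaps_refl by auto
  ultimately show ?thesis unfolding n_factor_def by simp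
qed

text \<open>
  By \<open>chart_overlap_tangent\<close> the two tangent bases are related as \<open>minor_of_swap\<close> requires.
\<close>

lemma n_factor_swap:
  assumes c: "chart S U (insert i J) f G D" and c': "chart S U' (insert j J) f' G' D'"
    and ij: "i \<notin> J" "j \<notin> J" "i \<noteq> j" and p: "p \<in> S \<inter> U" "p \<in> S \<inter> U'"
  shows "n_factor (insert i J) f p = ennreal \<bar>coord (D p (\<e> i)) j\<bar> * n_factor (insert j J) f' p"
proof -
  let ?I = "insert i J" and ?I' = "insert j J"
  let ?t = "tangent_coord (D p)" and ?u = "tangent_coord (D' p)"
  have pG: "p \<in> G" "p \<in> G'" and gp: "graph_map ?I f p = p" "graph_map ?I' f' p = p"
    using chart_point[OF c p(1)] chart_point[OF c' p(2)] by auto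
  have t: "?t k l = (if k = l then 1 else 0)" if "k \<in> ?I" "l \<in> ?I" for k l
    using coord_chart_derivative[OF c pG(1) that(2)] by (simp add: tangent_coord_def coord_unit)
  have u: "?u k l = (if k = l then 1 else 0)" if "k \<in> ?I'" "l \<in> ?I'" for k l
    using coord_chart_derivative[OF c' pG(2) that(2)] by (simp add: tangent_coord_def coord_unit)
  have tangent: "\<e> k + D p (\<e> k) = proj ?I' (\<e> k + D p (\<e> k)) + D' p (proj ?I' (\<e> k + D p (\<e> k)))"
    if "k \<in> ?I" for k
    using chart_overlap_tangent[OF c c' pG(1) gp(1), of "\<e> k"] that p(2)
    by (simp add: proj_unit chart_derivative_proj_arg[OF c' pG(2)])
  \<comment> \<open>Infinitely many coordinates are harmless: on \<open>J\<close> a tangent basis vector is a unit vector or zero.\<close>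
  have dec: "proj ?I' (\<e> k + D p (\<e> k)) = (if k = i then 0 else \<e> k) + ?t k j *\<^sub>R \<e> j" if k: "k \<in> ?I" for k
  proof (rule ell2_eqI)
    fix l
    have "l \<in> J \<Longrightarrow> coord (\<e> k + D p (\<e> k)) l = (if k = l then 1 else 0)"
      using t[OF k, of l] by (simp add: tangent_coord_def)
    then show "coord (proj ?I' (\<e> k + D p (\<e> k))) l = coord ((if k = i then 0 else \<e> k) + ?t k j *\<^sub>R \<e> j) l"
      using k ij by (auto simp: coord_proj coord_unit tangent_coord_def)
  qed
  have ti: "?t i l = ?t i j * ?u j l" for l
  proof -
    define a where "a = ?t i j"
    have "\<e> i + D p (\<e> i) = a *\<^sub>R \<e> j + D' p (a *\<^sub>R \<e> j)"
      using tangent[of i] dec[of i] by (simp add: a_def)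
    from arg_cong[OF this, of "\<lambda>z. coord z l"] have "?t i l = a * ?u j l"
      by (simp add: tangent_coord_def blinfun.scaleR_right algebra_simps)
    then show ?thesis by (simp add: a_def)
  qed
  have tk: "?t k l = ?u k l + ?t k j * ?u j l" if "k \<in> J" for k l
  proof -
    define b where "b = ?t k j"
    have "\<e> k + D p (\<e> k) = \<e> k + b *\<^sub>R \<e> j + D' p (\<e> k + b *\<^sub>R \<e> j)"
      using tangent[of k] dec[of k] that ij by (auto simp: b_def)
    from arg_cong[OF this, of "\<lambda>z. coord z l"] have "?t k l = ?u k l + b * ?u j l"
      by (simp add: tangent_coord_def blinfun.scaleR_right blinfun.add_right algebra_simps)
    then show ?thesis by (simp add: b_def)
  qed
  have tij: "?t i j = coord (D p (\<e> i)) j" using ij by (simp add: tangent_coord_def coord_unit)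
  have "?t i i = 1" using t[of i i] by simp
  then have nz: "?t i j \<noteq> 0" using ti[of i] by auto
  have "n_factor ?I f p = ennreal_sqrt (\<Sum>\<^sub>\<infinity>L\<in>finite_swaps ?I.
      ennreal (\<bar>?t i j\<bar>\<^sup>2) * ennreal ((minor_of ?u (?I' - L) (L - ?I'))\<^sup>2))"
    unfolding n_factor_eq[OF c pG(1), unfolded gp]
  proof (intro arg_cong[where f = ennreal_sqrt] infsum_cong)
    fix L assume L: "L \<in> finite_swaps ?I"
    have "minor_of ?t (?I - L) (L - ?I) = \<bar>?t i j\<bar> * minor_of ?u (?I' - L) (L - ?I')"
      by (rule minor_of_swap[OF ij _ _ _ t u ti tk]) (use L in \<open>auto simp: finite_swaps_def\<close>)
    then show "ennreal ((minor_of ?t (?I - L) (L - ?I))\<^sup>2)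
        = ennreal (\<bar>?t i j\<bar>\<^sup>2) * ennreal ((minor_of ?u (?I' - L) (L - ?I'))\<^sup>2)"
      by (simp only: power_mult_distrib) (simp add: ennreal_mult)
  qed
  also have "\<dots> = ennreal \<bar>?t i j\<bar> * n_factor ?I' f' p"
    unfolding n_factor_eq[OF c' pG(2), unfolded gp] infsum_cmult_ennreal
      finite_swaps_eq[OF finite_swaps_insert[OF ij(1,2)]]
    by (rule ennreal_sqrt_scale) (use nz in simp)
  finally show ?thesis by (simp add: tij)
qed


lemma n_factor_measurable:
  assumes c: "chart S U I f G D"
  shows "(\<lambda>x. n_factor I f (graph_map I f x)) \<in> borel_measurable (restrict_space borel G)"
proof -
  have D: "(\<lambda>x. tangent_coord (D x) k l) \<in> borel_measurable (restrict_space borel G)" for k l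
    unfolding tangent_coord_def
    by (intro borel_measurable_continuous_on_restrict continuous_intros
        chart_derivative_continuous[OF c])
  have sqrt: "ennreal_sqrt \<in> borel_measurable borel"
    unfolding ennreal_sqrt_def[abs_def] by measurable
  have "(\<lambda>x. \<Sum>\<^sub>\<infinity>L\<in>finite_swaps I.
      ennreal ((minor_of (tangent_coord (D x)) (I - L) (L - I))\<^sup>2)) \<in> borel_measurable (restrict_space borel G)"
    unfolding minor_of_def absdet_def
    by (intro borel_measurable_infsum_ennreal countable_finite_swaps
        measurable_compose[OF _ measurable_ennreal] borel_measurable_power borel_measurable_abs
        borel_measurable_det D)
  from measurable_compose[OF this sqrt]
  show ?thesis
    by (rule measurable_cong[THEN iffD1, rotated]) (simp add: n_factor_eq[OF c] space_restrict_space)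
qed

definition log_normal :: "(nat \<Rightarrow> real) \<Rightarrow> nat \<Rightarrow> real \<Rightarrow> real"
  where "log_normal a i s = ln (1 / sqrt (2 * pi * (a i)\<^sup>2)) - s\<^sup>2 / (2 * (a i)\<^sup>2)"

definition log_term :: "(nat \<Rightarrow> real) \<Rightarrow> nat set \<Rightarrow> ell2 \<Rightarrow> nat \<Rightarrow> real"
  where "log_term a I x i = (if i \<in> I then log_normal a i (coord x i) else 0)"

text \<open>
  The product of the normal densities as the exponential of a sum of logarithms.  It depends only on
  the coordinates in \<open>I\<close>, so it can be evaluated at the point of the surface itself instead of its
  projection.
\<close>

definition density_prod :: "(nat \<Rightarrow> real) \<Rightarrow> nat set \<Rightarrow> ell2 \<Rightarrow> ennreal"
  where "density_prod a I x = (if summable (\<lambda>i. \<bar>log_term a I x i\<bar>)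
    then ennreal (exp (\<Sum>i. log_term a I x i)) else \<infinity>)"

lemma exp_log_normal: "a i > 0 \<Longrightarrow> exp (log_normal a i s) = normal_density 0 (a i) s"
proof -
  assume "a i > 0"
  then have "1 / sqrt (2 * pi * (a i)\<^sup>2) > 0" by simp
  then have "exp (ln (1 / sqrt (2 * pi * (a i)\<^sup>2)) + - (s\<^sup>2 / (2 * (a i)\<^sup>2)))
      = 1 / sqrt (2 * pi * (a i)\<^sup>2) * exp (- (s\<^sup>2 / (2 * (a i)\<^sup>2)))"
    unfolding exp_add by (simp only: exp_ln)
  then show ?thesis by (simp only: log_normal_def normal_density_def diff_conv_add_uminus
      minus_zero add_0_right minus_divide_left)
qed

lemma density_prod_cong:
  "(\<And>i. i \<in> I \<Longrightarrow> coord x i = coord y i) \<Longrightarrow> density_prod a I x = density_prod a I y"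
proof -
  assume "\<And>i. i \<in> I \<Longrightarrow> coord x i = coord y i"
  then have "log_term a I x = log_term a I y" by (auto simp: log_term_def)
  then show ?thesis by (simp only: density_prod_def)
qed

text \<open>
  Absolute summability of the logarithms makes the infinite product the exponential of their sum; the
  value 1 for the empty index set is the empty product.
\<close>

lemma F_density_eq:
  assumes a: "\<And>i. a i > 0" and x: "x \<in> subspace_of I"
  shows "F_density a I x = density_prod a I x"
proof -
  have "x \<in> C_set a I \<longleftrightarrow> (\<lambda>i. \<bar>log_normal a i (coord x i)\<bar>) summable_on I"
    using x by (simp add: C_set_def log_normal_def)
  also have "\<dots> \<longleftrightarrow> (\<lambda>i. \<bar>log_term a I x i\<bar>) summable_on UNIV"
    by (rule summable_on_cong_neutral) (auto simp: log_term_def)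
  also have "\<dots> \<longleftrightarrow> summable (\<lambda>i. \<bar>log_term a I x i\<bar>)"
    by (rule summable_on_UNIV_nonneg_real_iff) simp
  finally have C: "x \<in> C_set a I \<longleftrightarrow> summable (\<lambda>i. \<bar>log_term a I x i\<bar>)" .
  have N: "(if i \<in> I then normal_density 0 (a i) (coord x i) else 1) = exp (log_term a I x i)" for i
    using exp_log_normal[of a i, OF a] by (simp add: log_term_def)
  have prod: "prodinf (\<lambda>i. if i \<in> I then normal_density 0 (a i) (coord x i) else 1)
      = exp (\<Sum>i. log_term a I x i)" if "summable (\<lambda>i. \<bar>log_term a I x i\<bar>)"
    unfolding N by (rule prodinf_exp[OF summable_rabs_cancel[OF that]])
  have "log_term a {} x = (\<lambda>_. 0)" by (auto simp: log_term_def)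
  then have "density_prod a {} x = 1" by (simp add: density_prod_def)
  then show ?thesis
  proof (cases "I = {}")
    case False
    then show ?thesis
      unfolding F_density_def C density_prod_def
      by (cases "summable (\<lambda>i. \<bar>log_term a I x i\<bar>)") (simp_all only: prod if_True if_False)
  qed (simp add: F_density_def)
qed

text \<open>
  A single logarithm does not affect summability, and the new factor is positive, so it keeps the
  value \<open>\<infinity>\<close> where the product diverges.
\<close>

lemma density_prod_insert:
  assumes "a j > 0" "j \<notin> R"
  shows "density_prod a (insert j R) x
    = density_prod a R x * ennreal (normal_density 0 (a j) (coord x j))"
proof -
  let ?g = "log_term a R x" and ?h = "\<lambda>i. if i = j then log_normal a j (coord x j) else 0"
  have eq: "log_term a (insert j R) x = (\<lambda>i. ?g i + ?h i)"
    by (rule ext) (use assms in \<open>simp add: log_term_def\<close>)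
  have h: "?h sums log_normal a j (coord x j)"
    by (rule sums_single[of j "\<lambda>_. log_normal a j (coord x j)"])
  have "summable (\<lambda>i. \<bar>?g i + ?h i\<bar>) \<longleftrightarrow> summable (\<lambda>i. \<bar>?g i\<bar>)"
    by (rule summable_cong, rule eventually_mono[OF eventually_gt_at_top[of j]]) simp
  moreover have "exp (\<Sum>i. ?g i + ?h i) = exp (\<Sum>i. ?g i) * normal_density 0 (a j) (coord x j)"
    if "summable (\<lambda>i. \<bar>?g i\<bar>)"
    using suminf_add[OF summable_rabs_cancel[OF that] sums_summable[OF h], symmetric] sums_unique[OF h]
    by (simp add: exp_add exp_log_normal[of a j, OF assms(1)])
  moreover have "normal_density 0 (a j) (coord x j) > 0" using normal_density_pos assms by blast
  ultimately show ?thesis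
    unfolding density_prod_def eq by (auto simp: ennreal_mult' ennreal_top_mult)
qed

text \<open>
  For nonnegative terms, summability means that the sum of the extended reals is finite.
\<close>

lemma sets_Collect_summable:
  fixes f :: "nat \<Rightarrow> 'a \<Rightarrow> real"
  assumes "\<And>i. f i \<in> borel_measurable M" "\<And>i x. 0 \<le> f i x"
  shows "{x \<in> space M. summable (\<lambda>i. f i x)} \<in> sets M"
proof -
  let ?T = "\<lambda>x. \<Sum>i. ennreal (f i x)"
  have T: "?T \<in> borel_measurable M"
    by (rule borel_measurable_suminf_order)
      (rule measurable_compose[OF assms(1) measurable_ennreal])
  have "summable (\<lambda>i. f i x) \<longleftrightarrow> ?T x \<in> - {\<infinity>}" for x
  proof
    assume "summable (\<lambda>i. f i x)"
    then have "?T x = ennreal (\<Sum>i. f i x)"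
      by (intro suminf_ennreal_eq assms(2) summable_sums)
    also have "\<dots> \<in> - {\<infinity>}" by simp
    finally show "?T x \<in> - {\<infinity>}" .
  next
    assume "?T x \<in> - {\<infinity>}"
    then show "summable (\<lambda>i. f i x)"
      unfolding infinity_ennreal_def by (intro summable_suminf_not_top assms(2)) blast
  qed
  then have "{x \<in> space M. summable (\<lambda>i. f i x)} = ?T -` (- {\<infinity>}) \<inter> space M"
    by blast
  also have "\<dots> \<in> sets M"
    by (rule measurable_sets[OF T]) (intro borel_open open_Compl closed_singleton)
  finally show ?thesis .
qed

lemma density_prod_measurable: "density_prod a I \<in> borel_measurable borel"
proof -
  have c: "(\<lambda>x. coord x i) \<in> borel_measurable borel" for i
    by (intro borel_measurable_continuous_onI continuous_intros)
  have t: "(\<lambda>x. log_term a I x i) \<in> borel_measurable borel" for i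
  proof (cases "i \<in> I")
    case True
    show ?thesis unfolding log_term_def log_normal_def if_P[OF True]
      by (intro borel_measurable_diff borel_measurable_const borel_measurable_divide borel_measurable_power c)
  qed (simp add: log_term_def)
  note sm = sets_Collect_summable[OF borel_measurable_abs[OF t] abs_ge_zero]
  have "(\<lambda>x. \<Sum>i. log_term a I x i) \<in> borel_measurable borel"
    by (intro borel_measurable_suminf t)
  moreover have "(\<lambda>r :: real. ennreal (exp r)) \<in> borel_measurable borel" by measurable
  ultimately have "(\<lambda>x. ennreal (exp (\<Sum>i. log_term a I x i))) \<in> borel_measurable borel"
    by (rule measurable_compose)
  then show ?thesis
    unfolding density_prod_def[abs_def] by (intro measurable_If sm measurable_const) simp_all
qed

section \<open>Change of variables on the line and the Gaussian measure\<close>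

text \<open>
  The change of variables formula for the constant function 1 on the image; if one side is infinite,
  then so is the other, because integrability of the constant and of the derivative are equivalent.
\<close>

lemma emeasure_image_real:
  fixes \<phi> \<phi>' :: "real \<Rightarrow> real"
  assumes A: "A \<in> sets borel"
    and d: "\<And>s. s \<in> A \<Longrightarrow> (\<phi> has_real_derivative \<phi>' s) (at s within A)"
    and inj: "inj_on \<phi> A" and img: "\<phi> ` A \<in> sets borel"
    and m: "(\<lambda>s. \<bar>\<phi>' s\<bar> * indicator A s) \<in> borel_measurable borel"
  shows "emeasure lborel (\<phi> ` A) = (\<integral>\<^sup>+ s. ennreal \<bar>\<phi>' s\<bar> * indicator A s \<partial>lborel)"
proof -
  have A': "A \<in> sets lebesgue" using A by simp
  have cv: "(\<lambda>s. \<bar>\<phi>' s\<bar> * 1) absolutely_integrable_on A \<and> integral A (\<lambda>s. \<bar>\<phi>' s\<bar> * 1) = b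
      \<longleftrightarrow> (\<lambda>_. 1 :: real) absolutely_integrable_on (\<phi> ` A) \<and> integral (\<phi> ` A) (\<lambda>_. 1) = b" for b
    by (rule has_absolute_integral_change_of_variables_1'[OF A' d inj, where f = "\<lambda>_. 1"])
  have lm: "(\<lambda>_. 1 :: real) absolutely_integrable_on (\<phi> ` A) \<longleftrightarrow> \<phi> ` A \<in> lmeasurable"
    by (simp add: absolutely_integrable_on_iff_nonneg lmeasurable_iff_integrable_on)
  have em: "emeasure lebesgue (\<phi> ` A) = emeasure lborel (\<phi> ` A)" using img by simp
  show ?thesis
  proof (cases "\<phi> ` A \<in> lmeasurable")
    case True
    then have "(\<lambda>s. \<bar>\<phi>' s\<bar>) absolutely_integrable_on A"
      and *: "integral A (\<lambda>s. \<bar>\<phi>' s\<bar>) = measure lebesgue (\<phi> ` A)"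
      using cv[of "measure lebesgue (\<phi> ` A)"] lm lmeasure_integral[OF True] by auto
    then have "((\<lambda>s. \<bar>\<phi>' s\<bar>) has_integral measure lebesgue (\<phi> ` A)) A"
      using set_lebesgue_integral_eq_integral(1) by (metis has_integral_iff)
    then have "(\<integral>\<^sup>+ s. ennreal \<bar>\<phi>' s\<bar> * indicator A s \<partial>lborel) = ennreal (measure lebesgue (\<phi> ` A))"
      by (intro nn_integral_has_integral_lebesgue') auto
    then show ?thesis using emeasure_eq_measure2[OF True] em by simp
  next
    case False
    have "(\<integral>\<^sup>+ s. ennreal \<bar>\<phi>' s\<bar> * indicator A s \<partial>lborel) = \<infinity>"
    proof (rule ccontr)
      assume "\<not> ?thesis"
      then obtain r where r: "0 \<le> r" "(\<integral>\<^sup>+ s. ennreal \<bar>\<phi>' s\<bar> * indicator A s \<partial>lborel) = ennreal r"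
        by (cases "\<integral>\<^sup>+ s. ennreal \<bar>\<phi>' s\<bar> * indicator A s \<partial>lborel") auto
      have "(\<integral>\<^sup>+ s. ennreal (\<bar>\<phi>' s\<bar> * indicator A s) \<partial>lborel) = ennreal r"
        unfolding r(2)[symmetric] by (intro nn_integral_cong) (auto simp: indicator_def)
      then have "((\<lambda>s. \<bar>\<phi>' s\<bar> * indicator A s) has_integral r) UNIV"
        using r(1) by (intro nn_integral_has_integral m) auto
      moreover have "(\<lambda>s. \<bar>\<phi>' s\<bar> * indicator A s) = (\<lambda>s. if s \<in> A then \<bar>\<phi>' s\<bar> else 0)"
        by (auto simp: indicator_def)
      ultimately have "(\<lambda>s. \<bar>\<phi>' s\<bar>) integrable_on A"
        using has_integral_restrict_UNIV by (metis integrable_on_def)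
      then have "(\<lambda>s. \<bar>\<phi>' s\<bar>) absolutely_integrable_on A"
        by (simp add: absolutely_integrable_on_iff_nonneg)
      then show False using cv[of "integral A (\<lambda>s. \<bar>\<phi>' s\<bar>)"] lm False by simp
    qed
    moreover have "emeasure lborel (\<phi> ` A) = \<infinity>"
    proof (rule ccontr)
      assume "\<not> ?thesis"
      then have "emeasure lebesgue (\<phi> ` A) < \<infinity>" using em by (simp add: less_top)
      then have "\<phi> ` A \<in> lmeasurable" using img by (intro fmeasurableI) auto
      then show False using False by blast
    qed
    ultimately show ?thesis by simp
  qed
qed

text \<open>
  The image under \<open>\<phi>\<close> of the measure with density \<open>\<bar>\<phi>'\<bar>\<close> on \<open>A\<close> is Lebesgue measure on \<open>\<phi> ` A\<close>: by the
  previous lemma the two agree on every Borel set.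
\<close>

lemma nn_integral_image_real:
  fixes \<phi> \<phi>' :: "real \<Rightarrow> real" and h :: "real \<Rightarrow> ennreal"
  assumes A: "A \<in> sets borel"
    and d: "\<And>s. s \<in> A \<Longrightarrow> (\<phi> has_real_derivative \<phi>' s) (at s within A)"
    and inj: "inj_on \<phi> A" and img: "\<phi> ` A \<in> sets borel"
    and m: "\<phi>' \<in> borel_measurable (restrict_space borel A)"
    and h: "h \<in> borel_measurable borel"
  shows "(\<integral>\<^sup>+ t. h t * indicator (\<phi> ` A) t \<partial>lborel)
    = (\<integral>\<^sup>+ s. ennreal \<bar>\<phi>' s\<bar> * h (\<phi> s) * indicator A s \<partial>lborel)"
proof -
  let ?R = "restrict_space lborel A"
  have A2: "A \<inter> space lborel \<in> sets lborel" using A by simp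
  have sR: "sets ?R = sets (restrict_space borel A)" by (simp add: sets_restrict_space)
  have phi: "\<phi> \<in> borel_measurable ?R"
  proof -
    have "continuous_on A \<phi>"
      using d DERIV_continuous by (metis continuous_on_eq_continuous_within)
    then have "\<phi> \<in> borel_measurable (restrict_space borel A)"
      by (rule borel_measurable_continuous_on_restrict)
    then show ?thesis using measurable_cong_sets[OF sR refl] by blast
  qed
  have m': "(\<lambda>s. ennreal \<bar>\<phi>' s\<bar>) \<in> borel_measurable ?R"
    using m measurable_cong_sets[OF sR refl, of borel] by auto
  let ?M1 = "distr (density ?R (\<lambda>s. ennreal \<bar>\<phi>' s\<bar>)) borel \<phi>"
  let ?M2 = "density lborel (indicator (\<phi> ` A))"
  have phi': "\<phi> \<in> borel_measurable (density ?R (\<lambda>s. ennreal \<bar>\<phi>' s\<bar>))" using phi by simp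
  have "?M1 = ?M2"
  proof (rule measure_eqI)
    fix B assume "B \<in> sets ?M1"
    then have B: "B \<in> sets borel" by simp
    define C where "C = A \<inter> \<phi> -` B"
    have C: "C \<in> sets borel"
    proof -
      have "\<phi> -` B \<inter> space ?R \<in> sets ?R" using measurable_sets[OF phi B] .
      then have "C \<in> sets ?R" by (simp add: C_def space_restrict_space Int_commute)
      then show ?thesis using A2 by (auto simp: sets_restrict_space_iff)
    qed
    have "emeasure ?M1 B = emeasure (density ?R (\<lambda>s. ennreal \<bar>\<phi>' s\<bar>)) (\<phi> -` B \<inter> space ?R)"
      using emeasure_distr[OF phi' B] by simp
    also have "\<dots> = (\<integral>\<^sup>+ s. ennreal \<bar>\<phi>' s\<bar> * indicator (\<phi> -` B \<inter> space ?R) s \<partial>?R)"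
      by (rule emeasure_density[OF m' measurable_sets[OF phi B]])
    also have "\<dots> = (\<integral>\<^sup>+ s. ennreal \<bar>\<phi>' s\<bar> * indicator (\<phi> -` B \<inter> space ?R) s * indicator A s \<partial>lborel)"
      by (rule nn_integral_restrict_space[OF A2])
    also have "\<dots> = (\<integral>\<^sup>+ s. ennreal \<bar>\<phi>' s\<bar> * indicator C s \<partial>lborel)"
      by (intro nn_integral_cong) (auto simp: indicator_def C_def space_restrict_space)
    also have "\<dots> = emeasure lborel (\<phi> ` C)"
    proof (rule emeasure_image_real[symmetric, OF C])
      show "(\<phi> has_real_derivative \<phi>' s) (at s within C)" if "s \<in> C" for s
        using d[of s] that by (auto simp: C_def intro: has_field_derivative_subset)
      show "inj_on \<phi> C" using inj by (auto simp: C_def inj_on_def)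
      have "\<phi> ` C = \<phi> ` A \<inter> B" by (auto simp: C_def)
      then show "\<phi> ` C \<in> sets borel" using img B by simp
      have "\<phi>' \<in> borel_measurable (restrict_space borel C)"
        using m by (rule measurable_restrict_mono) (auto simp: C_def)
      then have "(\<lambda>s. indicator C s *\<^sub>R \<bar>\<phi>' s\<bar>) \<in> borel_measurable borel"
        using borel_measurable_restrict_space_iff[of C borel "\<lambda>s. \<bar>\<phi>' s\<bar>"] C by auto
      then show "(\<lambda>s. \<bar>\<phi>' s\<bar> * indicator C s) \<in> borel_measurable borel"
        by (simp add: mult.commute)
    qed
    also have "\<phi> ` C = \<phi> ` A \<inter> B" by (auto simp: C_def)
    also have "emeasure lborel (\<phi> ` A \<inter> B) = emeasure ?M2 B"
      using img B by (subst emeasure_density) (auto simp: indicator_inter_arith[symmetric])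
    finally show "emeasure ?M1 B = emeasure ?M2 B" .
  qed simp
  then have "(\<integral>\<^sup>+ t. h t \<partial>?M1) = (\<integral>\<^sup>+ t. h t \<partial>?M2)" by simp
  moreover have "(\<integral>\<^sup>+ t. h t \<partial>?M2) = (\<integral>\<^sup>+ t. h t * indicator (\<phi> ` A) t \<partial>lborel)"
    using img h by (subst nn_integral_density) (auto simp: mult.commute)
  moreover have "(\<integral>\<^sup>+ t. h t \<partial>?M1) = (\<integral>\<^sup>+ s. h (\<phi> s) \<partial>density ?R (\<lambda>s. ennreal \<bar>\<phi>' s\<bar>))"
    by (rule nn_integral_distr[OF phi']) (use h in simp)
  moreover have "\<dots> = (\<integral>\<^sup>+ s. ennreal \<bar>\<phi>' s\<bar> * h (\<phi> s) \<partial>?R)"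
    by (rule nn_integral_density[OF m' measurable_compose[OF phi h]])
  moreover have "\<dots> = (\<integral>\<^sup>+ s. ennreal \<bar>\<phi>' s\<bar> * h (\<phi> s) * indicator A s \<partial>lborel)"
    by (rule nn_integral_restrict_space[OF A2])
  ultimately show ?thesis by simp
qed


lemma partial_sums_tendsto: "(\<lambda>n. \<Sum>k<n. coord x k *\<^sub>R \<e> k) \<longlonglongrightarrow> x"
proof -
  let ?X = "\<lambda>n. \<Sum>k<n. coord x k *\<^sub>R \<e> k"
  have cX: "coord (?X n) i = (if i < n then coord x i else 0)" for n i
  proof -
    have "coord (?X n) i = (\<Sum>k<n. if k = i then coord x k else 0)"
      unfolding coord_sum by (rule sum.cong) (auto simp: coord_unit)
    then show ?thesis by simp
  qed
  have "(norm (?X n - x))\<^sup>2 = (\<Sum>i. (coord x (i + n))\<^sup>2)" for n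
  proof -
    have "(norm (?X n - x))\<^sup>2 = (\<Sum>i. (coord (?X n - x) (i + n))\<^sup>2) + (\<Sum>i<n. (coord (?X n - x) i)\<^sup>2)"
      unfolding norm_ell2_sq by (rule suminf_split_initial_segment[OF summable_coord])
    then show ?thesis by (simp add: cX)
  qed
  moreover have "(\<lambda>n. \<Sum>i. (coord x (i + n))\<^sup>2) \<longlonglongrightarrow> 0"
    by (rule suminf_exist_split2[OF summable_coord])
  ultimately have "(\<lambda>n. (norm (?X n - x))\<^sup>2) \<longlonglongrightarrow> 0" by simp
  from tendsto_real_sqrt[OF this] have "(\<lambda>n. norm (?X n - x)) \<longlonglongrightarrow> 0" by simp
  then show ?thesis by (subst LIM_zero_iff[symmetric]) (rule tendsto_norm_zero_cancel)
qed

text \<open>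
  A vector is the limit of its finite coordinate expansions, which are measurable.
\<close>

lemma measurable_ell2I:
  assumes "\<And>i. (\<lambda>x. coord (f x) i) \<in> borel_measurable M"
  shows "f \<in> borel_measurable M"
proof (rule borel_measurable_LIMSEQ_metric)
  show "(\<lambda>x. \<Sum>k<n. coord (f x) k *\<^sub>R \<e> k) \<in> borel_measurable M" for n
    by (intro borel_measurable_sum borel_measurable_scaleR assms borel_measurable_const)
  show "(\<lambda>n. \<Sum>k<n. coord (f x) k *\<^sub>R \<e> k) \<longlonglongrightarrow> f x" if "x \<in> space M" for x
    by (rule partial_sums_tendsto)
qed

definition normal_measure :: "real \<Rightarrow> real measure"
  where "normal_measure \<sigma> = density lborel (\<lambda>x. ennreal (normal_density 0 \<sigma> x))"

definition square_summable_on :: "nat set \<Rightarrow> (nat \<Rightarrow> real) set"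
  where "square_summable_on I = {x. (\<lambda>i. (x i)\<^sup>2) summable_on I}"

definition to_ell2 :: "nat set \<Rightarrow> (nat \<Rightarrow> real) \<Rightarrow> ell2"
  where "to_ell2 I x = Abs_ell2 (\<lambda>i. if i \<in> I then x i else 0)"

lemma square_summable_on_iff:
  "x \<in> square_summable_on I \<longleftrightarrow> summable (\<lambda>i. (if i \<in> I then x i else 0)\<^sup>2)"
proof -
  have "x \<in> square_summable_on I \<longleftrightarrow> (\<lambda>i. (if i \<in> I then x i else 0)\<^sup>2) summable_on UNIV"
    unfolding square_summable_on_def mem_Collect_eq by (rule summable_on_cong_neutral) auto
  also have "\<dots> \<longleftrightarrow> summable (\<lambda>i. (if i \<in> I then x i else 0)\<^sup>2)"
    by (rule summable_on_UNIV_nonneg_real_iff) simp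
  finally show ?thesis .
qed

lemma coord_to_ell2:
  "x \<in> square_summable_on I \<Longrightarrow> coord (to_ell2 I x) i = (if i \<in> I then x i else 0)"
  unfolding to_ell2_def square_summable_on_iff by (subst coord_Abs) auto

lemma sets_normal_measure [measurable_cong]: "sets (normal_measure \<sigma>) = sets borel"
  and space_normal_measure [simp]: "space (normal_measure \<sigma>) = UNIV"
  by (simp_all add: normal_measure_def)

lemma square_summable_on_measurable:
  "square_summable_on I \<inter> space (\<Pi>\<^sub>M i\<in>I. normal_measure (a i)) \<in> sets (\<Pi>\<^sub>M i\<in>I. normal_measure (a i))"
proof -
  let ?P = "\<Pi>\<^sub>M i\<in>I. normal_measure (a i)"
  have "(\<lambda>x. (if i \<in> I then x i else 0)\<^sup>2) \<in> borel_measurable ?P" for i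
  proof (cases "i \<in> I")
    case True
    have "(\<lambda>x. x i) \<in> borel_measurable ?P"
      using measurable_component_singleton[OF True, of "\<lambda>i. normal_measure (a i)"]
      unfolding measurable_cong_sets[OF refl sets_normal_measure] .
    then show ?thesis using True by simp
  qed simp
  then have "{x \<in> space ?P. summable (\<lambda>i. (if i \<in> I then x i else 0)\<^sup>2)} \<in> sets ?P"
    by (rule sets_Collect_summable) simp
  also have "{x \<in> space ?P. summable (\<lambda>i. (if i \<in> I then x i else 0)\<^sup>2)} = square_summable_on I \<inter> space ?P"
    using square_summable_on_iff by blast
  finally show ?thesis .
qed

lemma to_ell2_measurable:
  "to_ell2 I \<in> borel_measurable
    (restrict_space (\<Pi>\<^sub>M i\<in>I. normal_measure (a i)) (square_summable_on I))"
proof (rule measurable_ell2I)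
  fix i
  let ?P = "\<Pi>\<^sub>M i\<in>I. normal_measure (a i)"
  have "(\<lambda>x. if i \<in> I then x i else 0) \<in> borel_measurable ?P"
  proof (cases "i \<in> I")
    case True
    have "(\<lambda>x. x i) \<in> borel_measurable ?P"
      using measurable_component_singleton[OF True, of "\<lambda>i. normal_measure (a i)"]
      unfolding measurable_cong_sets[OF refl sets_normal_measure] .
    then show ?thesis using True by simp
  qed simp
  then have "(\<lambda>x. if i \<in> I then x i else 0) \<in> borel_measurable (restrict_space ?P (square_summable_on I))"
    by (rule measurable_restrict_space1)
  then show "(\<lambda>x. coord (to_ell2 I x) i) \<in> borel_measurable (restrict_space ?P (square_summable_on I))"
    by (rule measurable_cong[THEN iffD1, rotated]) (simp add: coord_to_ell2 space_restrict_space)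
qed

lemma gauss_measure_alt:
  "gauss_measure a I = distr
    (restrict_space (\<Pi>\<^sub>M i\<in>I. normal_measure (a i)) (square_summable_on I))
    (restrict_space borel (subspace_of I)) (to_ell2 I)"
  unfolding gauss_measure_def normal_measure_def square_summable_on_def to_ell2_def ..

lemma space_gauss_measure: "space (gauss_measure a I) = subspace_of I"
  and sets_gauss_measure: "sets (gauss_measure a I) = sets (restrict_space borel (subspace_of I))"
  by (simp_all add: gauss_measure_alt space_restrict_space)

lemma nn_integral_gauss_measure:
  assumes g: "g \<in> borel_measurable borel"
  shows "(\<integral>\<^sup>+ x. g x \<partial>gauss_measure a I) =
    (\<integral>\<^sup>+ x. g (to_ell2 I x) * indicator (square_summable_on I) x \<partial>(\<Pi>\<^sub>M i\<in>I. normal_measure (a i)))"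
proof -
  let ?P = "\<Pi>\<^sub>M i\<in>I. normal_measure (a i)"
  have "to_ell2 I \<in> restrict_space ?P (square_summable_on I) \<rightarrow>\<^sub>M restrict_space borel (subspace_of I)"
    by (rule measurable_restrict_space2[OF _ to_ell2_measurable])
      (simp add: subspace_of_eq coord_to_ell2 space_restrict_space)
  then have "(\<integral>\<^sup>+ x. g x \<partial>gauss_measure a I)
      = (\<integral>\<^sup>+ x. g (to_ell2 I x) \<partial>restrict_space ?P (square_summable_on I))"
    unfolding gauss_measure_alt
    by (rule nn_integral_distr) (simp add: measurable_restrict_space1[OF g])
  also have "\<dots> = (\<integral>\<^sup>+ x. g (to_ell2 I x) * indicator (square_summable_on I) x \<partial>?P)"
    by (rule nn_integral_restrict_space[OF square_summable_on_measurable])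
  finally show ?thesis .
qed

text \<open>
  The product measure over \<open>insert i J\<close> splits off the factor \<open>i\<close>, and the value of one coordinate does
  not affect square summability.
\<close>

lemma nn_integral_gauss_measure_insert:
  assumes a: "\<And>i. a i > 0" and i: "i \<notin> J" and g: "g \<in> borel_measurable borel"
  shows "(\<integral>\<^sup>+ x. g x \<partial>gauss_measure a (insert i J)) =
    (\<integral>\<^sup>+ y. (\<integral>\<^sup>+ s. ennreal (normal_density 0 (a i) s) * g (y + s *\<^sub>R \<e> i) \<partial>lborel) \<partial>gauss_measure a J)"
proof -
  let ?N = "\<lambda>i. normal_measure (a i)"
  let ?PI = "\<Pi>\<^sub>M i\<in>insert i J. ?N i" and ?PJ = "\<Pi>\<^sub>M i\<in>J. ?N i"
  let ?G = "\<lambda>x. g (to_ell2 (insert i J) x) * indicator (square_summable_on (insert i J)) x"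
  let ?K = "\<lambda>y. \<integral>\<^sup>+ s. ennreal (normal_density 0 (a i) s) * g (y + s *\<^sub>R \<e> i) \<partial>lborel"
  have prob: "prob_space (?N k)" for k
    unfolding normal_measure_def by (rule prob_space_normal_density[OF a])
  interpret N: prob_space "?N i" by (rule prob)
  interpret J: prob_space ?PJ by (intro prob_space_PiM prob)
  interpret pair_sigma_finite "?N i" ?PJ ..
  have G: "?G \<in> borel_measurable ?PI"
  proof -
    have "(\<lambda>x. g (to_ell2 (insert i J) x)) \<in> borel_measurable (restrict_space ?PI (square_summable_on (insert i J)))"
      by (rule measurable_compose[OF to_ell2_measurable g])
    then show ?thesis
      by (rule borel_measurable_restrict_space_iff_ennreal[OF square_summable_on_measurable, THEN iffD1])
  qed
  have upd: "(\<lambda>(s, X). X(i := s)) \<in> ?N i \<Otimes>\<^sub>M ?PJ \<rightarrow>\<^sub>M ?PI"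
    using measurable_fun_upd[of "insert i J" J i snd "?N i \<Otimes>\<^sub>M ?PJ" ?N fst] by (simp add: split_beta)
  have Gupd: "?G (X(i := s)) = g (to_ell2 J X + s *\<^sub>R \<e> i) * indicator (square_summable_on J) X" for X s
  proof -
    have "summable (\<lambda>k. (if k \<in> insert i J then (X(i := s)) k else 0)\<^sup>2)
        \<longleftrightarrow> summable (\<lambda>k. (if k \<in> J then X k else 0)\<^sup>2)"
      by (rule summable_cong, rule eventually_mono[OF eventually_gt_at_top[of i]]) auto
    then have iff: "X(i := s) \<in> square_summable_on (insert i J) \<longleftrightarrow> X \<in> square_summable_on J"
      unfolding square_summable_on_iff .
    show ?thesis
    proof (cases "X \<in> square_summable_on J")
      case True
      then have "to_ell2 (insert i J) (X(i := s)) = to_ell2 J X + s *\<^sub>R \<e> i"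
        using iff i by (intro ell2_eqI) (auto simp: coord_to_ell2 coord_unit)
      then show ?thesis using True iff by simp
    qed (use iff in simp)
  qed
  have plus: "(\<lambda>p. g (fst p + snd p *\<^sub>R \<e> i)) \<in> borel_measurable (borel \<Otimes>\<^sub>M borel)"
    by (rule measurable_compose[OF _ g]) measurable
  have K: "?K \<in> borel_measurable borel"
  proof -
    have "(\<lambda>(y, s). ennreal (normal_density 0 (a i) s) * g (y + s *\<^sub>R \<e> i)) \<in> borel_measurable (borel \<Otimes>\<^sub>M lborel)"
      using plus by (simp add: split_beta' measurable_cong_sets[OF sets_pair_measure_cong[OF refl sets_lborel] refl])
    then show ?thesis by (rule lborel.borel_measurable_nn_integral)
  qed
  have "(\<integral>\<^sup>+ x. g x \<partial>gauss_measure a (insert i J)) = (\<integral>\<^sup>+ x. ?G x \<partial>?PI)"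
    by (rule nn_integral_gauss_measure[OF g])
  also have "\<dots> = (\<integral>\<^sup>+ x. ?G x \<partial>distr (?N i \<Otimes>\<^sub>M ?PJ) ?PI (\<lambda>(s, X). X(i := s)))"
    by (subst distr_pair_PiM_eq_PiM[OF prob prob]) simp
  also have "\<dots> = (\<integral>\<^sup>+ p. ?G ((\<lambda>(s, X). X(i := s)) p) \<partial>(?N i \<Otimes>\<^sub>M ?PJ))"
    by (rule nn_integral_distr[OF upd]) (use G in simp)
  also have "\<dots> = (\<integral>\<^sup>+ X. (\<integral>\<^sup>+ s. ?G ((\<lambda>(s, X). X(i := s)) (s, X)) \<partial>?N i) \<partial>?PJ)"
    by (rule nn_integral_snd[OF measurable_compose[OF upd G], symmetric])
  also have "\<dots> = (\<integral>\<^sup>+ X. ?K (to_ell2 J X) * indicator (square_summable_on J) X \<partial>?PJ)"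
  proof (rule nn_integral_cong)
    fix X
    have m: "(\<lambda>s. g (to_ell2 J X + s *\<^sub>R \<e> i)) \<in> borel_measurable borel"
      by (rule measurable_compose[OF _ g]) measurable
    have "(\<integral>\<^sup>+ s. ?G ((\<lambda>(s, X). X(i := s)) (s, X)) \<partial>?N i)
        = (\<integral>\<^sup>+ s. g (to_ell2 J X + s *\<^sub>R \<e> i) * indicator (square_summable_on J) X \<partial>?N i)"
      unfolding case_prod_conv Gupd ..
    also have "\<dots> = (\<integral>\<^sup>+ s. g (to_ell2 J X + s *\<^sub>R \<e> i) \<partial>?N i) * indicator (square_summable_on J) X"
      by (rule nn_integral_multc) (use m in simp)
    also have "(\<integral>\<^sup>+ s. g (to_ell2 J X + s *\<^sub>R \<e> i) \<partial>?N i) = ?K (to_ell2 J X)"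
      unfolding normal_measure_def by (rule nn_integral_density) (use m in simp_all)
    finally show "(\<integral>\<^sup>+ s. ?G ((\<lambda>(s, X). X(i := s)) (s, X)) \<partial>?N i)
        = ?K (to_ell2 J X) * indicator (square_summable_on J) X" .
  qed
  also have "\<dots> = (\<integral>\<^sup>+ y. ?K y \<partial>gauss_measure a J)"
    by (rule nn_integral_gauss_measure[OF K, symmetric])
  finally show ?thesis .
qed

section \<open>Consistency of the charts and the surface measure\<close>

text \<open>
  The right-hand side of the formula that characterises the surface measure.
\<close>

definition surface_content :: "(nat \<Rightarrow> real) \<Rightarrow> nat set \<Rightarrow> (ell2 \<Rightarrow> ell2) \<Rightarrow> ell2 set \<Rightarrow> ennreal"
  where "surface_content a I f E =
    (\<integral>\<^sup>+ x\<in>proj I ` E. n_factor I f (x + f x) * F_density a (- I) (f x) \<partial>gauss_measure a I)"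

lemma surface_content_empty: "surface_content a I f {} = 0"
  by (simp add: surface_content_def)

definition weight :: "(nat \<Rightarrow> real) \<Rightarrow> nat set \<Rightarrow> (ell2 \<Rightarrow> ell2) \<Rightarrow> ell2 \<Rightarrow> ennreal"
  where "weight a I f x = n_factor I f (graph_map I f x) * density_prod a (- I) (graph_map I f x)"

lemma restrict_Int_set:
  assumes "E \<in> sets (restrict_space borel T)"
  obtains B where "B \<in> sets borel" "E = B \<inter> T"
  using assms by (auto simp: sets_restrict_space)

lemma restrict_IntI: "B \<in> sets borel \<Longrightarrow> B \<inter> T \<in> sets (restrict_space borel T)"
  by (auto simp: sets_restrict_space)

lemma sets_restrict_subset:
  assumes "E \<in> sets (restrict_space borel T)" "B \<in> sets borel" "B \<inter> E \<subseteq> T'" "T' \<subseteq> T"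
  shows "B \<inter> E \<in> sets (restrict_space borel T')"
proof -
  obtain C where C: "C \<in> sets borel" "E = C \<inter> T" using assms(1) by (rule restrict_Int_set)
  have eq: "B \<inter> E = (B \<inter> C) \<inter> T'" using C assms by auto
  show ?thesis unfolding eq by (rule restrict_IntI) (use C assms(2) in auto)
qed

context
  fixes S U I f G D
  assumes c: "chart S U I f G D"
begin

lemma proj_image_eq:
  assumes "E \<subseteq> S \<inter> U"
  shows "proj I ` E = {x \<in> G. graph_map I f x \<in> E} \<inter> subspace_of I"
proof safe
  fix p assume p: "p \<in> E"
  then have "p \<in> S \<inter> U" using assms by blast
  note cp = chart_point[OF c this]
  show "proj I p \<in> G" using cp(1) chart_saturated[OF c] by simp
  show "graph_map I f (proj I p) \<in> E" using cp(2) p by (simp add: graph_map_proj[OF c])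
next
  fix x assume x: "x \<in> G" "graph_map I f x \<in> E" "x \<in> subspace_of I"
  then have "proj I (graph_map I f x) = x" using proj_graph_map[OF c] proj_id by simp
  then show "x \<in> proj I ` E" using x by (metis imageI)
qed simp

lemma graph_map_vimage_measurable:
  assumes "B \<in> sets borel"
  shows "{x \<in> G. graph_map I f x \<in> B} \<in> sets borel"
proof -
  have "graph_map I f \<in> borel_measurable (restrict_space borel G)"
    by (rule borel_measurable_continuous_on_restrict[OF continuous_on_graph_map[OF c]])
  from measurable_sets[OF this assms]
  have "{x \<in> G. graph_map I f x \<in> B} \<in> sets (restrict_space borel G)"
    by (simp add: space_restrict_space vimage_def Int_def conj_commute)
  then show ?thesis
    using chart_open(2)[OF c] by (subst (asm) sets_restrict_space_iff) auto
qed

lemma weight_measurable: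
  assumes "B \<in> sets borel"
  shows "(\<lambda>x. weight a I f x * indicator {x \<in> G. graph_map I f x \<in> B} x) \<in> borel_measurable borel"
proof -
  have gm: "graph_map I f \<in> borel_measurable (restrict_space borel G)"
    by (rule borel_measurable_continuous_on_restrict[OF continuous_on_graph_map[OF c]])
  have "weight a I f \<in> borel_measurable (restrict_space borel G)"
    unfolding weight_def[abs_def]
    by (intro borel_measurable_times_ennreal n_factor_measurable[OF c]
        measurable_compose[OF gm density_prod_measurable])
  then have "(\<lambda>x. weight a I f x * indicator G x) \<in> borel_measurable borel"
    by (rule borel_measurable_restrict_space_iff_ennreal[THEN iffD1, rotated])
      (simp add: borel_open[OF chart_open(2)[OF c]])
  then have "(\<lambda>x. weight a I f x * indicator G x * indicator {x \<in> G. graph_map I f x \<in> B} x)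
      \<in> borel_measurable borel"
    by (rule borel_measurable_times_ennreal[OF _ borel_measurable_indicator[OF
          graph_map_vimage_measurable[OF assms]]])
  moreover have "weight a I f x * indicator G x * indicator {x \<in> G. graph_map I f x \<in> B} x
      = weight a I f x * indicator {x \<in> G. graph_map I f x \<in> B} x" for x
    by (auto simp: indicator_def)
  ultimately show ?thesis by simp
qed

lemma proj_image_measurable:
  assumes "E \<in> sets (restrict_space borel (S \<inter> U))"
  shows "proj I ` E \<in> sets (gauss_measure a I)"
proof -
  obtain B where B: "B \<in> sets borel" "E = B \<inter> (S \<inter> U)" using assms by (rule restrict_Int_set)
  have "proj I ` E = {x \<in> G. graph_map I f x \<in> B} \<inter> subspace_of I"
    using proj_image_eq[of E] graph_map_in[OF c] B(2) by auto
  then show ?thesis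
    using graph_map_vimage_measurable[OF B(1)] by (auto simp: sets_gauss_measure sets_restrict_space)
qed

context
  fixes a :: "nat \<Rightarrow> real"
  assumes a: "\<And>i. a i > 0"
begin

lemma integrand_eq_weight:
  assumes "x \<in> G" "x \<in> subspace_of I"
  shows "n_factor I f (x + f x) * F_density a (- I) (f x) = weight a I f x"
proof -
  have p: "proj I x = x" using assms(2) by (rule proj_id)
  then have g: "graph_map I f x = x + f x" by (simp add: graph_map_def)
  have fx: "f x \<in> subspace_of (- I)" using chart_range[OF c assms(1)] p by simp
  have "F_density a (- I) (f x) = density_prod a (- I) (f x)"
    by (rule F_density_eq[OF a fx])
  also have "\<dots> = density_prod a (- I) (x + f x)"
    by (rule density_prod_cong) (use assms(2) in \<open>auto simp: subspace_of_eq\<close>)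
  finally show ?thesis by (simp add: weight_def g)
qed

lemma surface_content_eq:
  assumes "E \<subseteq> S \<inter> U"
  shows "surface_content a I f E =
    (\<integral>\<^sup>+ x. weight a I f x * indicator {x \<in> G. graph_map I f x \<in> E} x \<partial>gauss_measure a I)"
  unfolding surface_content_def
  by (intro nn_integral_cong)
    (auto simp: proj_image_eq[OF assms] indicator_def space_gauss_measure integrand_eq_weight)

lemma surface_content_UN:
  fixes E :: "nat \<Rightarrow> ell2 set"
  assumes E: "\<And>n. E n \<in> sets (restrict_space borel (S \<inter> U))" and d: "disjoint_family E"
  shows "surface_content a I f (\<Union>n. E n) = (\<Sum>n. surface_content a I f (E n))"
proof -
  let ?w = "\<lambda>x. weight a I f x * indicator {x \<in> G. graph_map I f x \<in> UNIV} x"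
  have sub: "E n \<subseteq> S \<inter> U" for n using sets.sets_into_space[OF E[of n]] by (simp add: space_restrict_space)
  have w: "?w \<in> borel_measurable (gauss_measure a I)"
    using measurable_restrict_space1[OF weight_measurable[of UNIV a]]
    by (simp add: measurable_cong_sets[OF sets_gauss_measure refl])
  have eq: "surface_content a I f F = (\<integral>\<^sup>+ x\<in>proj I ` F. ?w x \<partial>gauss_measure a I)"
    if "F \<subseteq> S \<inter> U" for F
    unfolding surface_content_eq[OF that]
    by (intro nn_integral_cong)
      (auto simp: proj_image_eq[OF that] indicator_def space_gauss_measure)
  have "disjoint_family (\<lambda>n. proj I ` E n)"
    unfolding disjoint_family_on_def
  proof (intro ballI impI)
    fix m n :: nat assume "m \<noteq> n"
    then have "E m \<inter> E n = {}" using d by (auto simp: disjoint_family_on_def)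
    then show "proj I ` E m \<inter> proj I ` E n = {}"
      by (auto simp: proj_image_eq[OF sub])
  qed
  then have "(\<integral>\<^sup>+ x\<in>(\<Union>n. proj I ` E n). ?w x \<partial>gauss_measure a I)
      = (\<Sum>n. \<integral>\<^sup>+ x\<in>proj I ` E n. ?w x \<partial>gauss_measure a I)"
    by (intro nn_integral_disjoint_family w proj_image_measurable E)
  then show ?thesis using sub by (simp add: eq image_UN UN_least)
qed

end

end

text \<open>
  After splitting off the \<open>i\<close>-th and the \<open>j\<close>-th coordinate, both sides are integrals over the same vectors
  \<open>y \<in> P\<^sub>J\<ell>\<^sup>2\<close>.  For fixed \<open>y\<close> the points of \<open>E\<close> with \<open>J\<close>-part \<open>y\<close> are parametrised by \<open>s = x\<^sub>i\<close> and
  by \<open>t = x\<^sub>j\<close>, and \<open>\<phi>\<close> expresses \<open>t\<close> by \<open>s\<close>.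
\<close>

lemma surface_content_swap:
  assumes a: "\<And>i. a i > 0"
    and c: "chart S U (insert i J) f G D" and c': "chart S U' (insert j J) f' G' D'"
    and ij: "i \<notin> J" "j \<notin> J" "i \<noteq> j"
    and E: "E = B \<inter> (S \<inter> U \<inter> U')" "B \<in> sets borel"
  shows "surface_content a (insert i J) f E = surface_content a (insert j J) f' E"
proof -
  let ?I = "insert i J" and ?I' = "insert j J" and ?R = "- insert i (insert j J)"
  let ?g = "graph_map ?I f" and ?g' = "graph_map ?I' f'"
  let ?N = "\<lambda>i s. ennreal (normal_density 0 (a i) s)"
  define Q where "Q = {x \<in> G. ?g x \<in> B \<inter> U'}"
  define Q' where "Q' = {x \<in> G'. ?g' x \<in> B \<inter> U}"
  define w where "w x = weight a ?I f x * indicator Q x" for x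
  define w' where "w' x = weight a ?I' f' x * indicator Q' x" for x
  have BU: "B \<inter> U \<in> sets borel" "B \<inter> U' \<in> sets borel"
    using E(2) chart_open(1)[OF c] chart_open(1)[OF c'] by auto
  have w: "w \<in> borel_measurable borel" and w': "w' \<in> borel_measurable borel"
    unfolding w_def[abs_def] w'_def[abs_def] Q_def Q'_def
    by (rule weight_measurable[OF c BU(2)] weight_measurable[OF c' BU(1)])+
  have QE: "Q = {x \<in> G. ?g x \<in> E}" and QE': "Q' = {x \<in> G'. ?g' x \<in> E}"
    using graph_map_in[OF c] graph_map_in[OF c'] by (auto simp: Q_def Q'_def E(1))
  have Qm: "Q \<in> sets borel" and Qm': "Q' \<in> sets borel"
    unfolding Q_def Q'_def
    by (rule graph_map_vimage_measurable[OF c BU(2)] graph_map_vimage_measurable[OF c' BU(1)])+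
  have sc: "surface_content a ?I f E = (\<integral>\<^sup>+ x. w x \<partial>gauss_measure a ?I)"
    unfolding w_def QE by (rule surface_content_eq[OF c a]) (use E(1) in auto)
  have sc': "surface_content a ?I' f' E = (\<integral>\<^sup>+ x. w' x \<partial>gauss_measure a ?I')"
    unfolding w'_def QE' by (rule surface_content_eq[OF c' a]) (use E(1) in auto)
  have inner: "(\<integral>\<^sup>+ s. ?N i s * w (y + s *\<^sub>R \<e> i) \<partial>lborel)
      = (\<integral>\<^sup>+ t. ?N j t * w' (y + t *\<^sub>R \<e> j) \<partial>lborel)" if y: "y \<in> subspace_of J" for y
  proof -
    define A where "A = {s. y + s *\<^sub>R \<e> i \<in> Q}"
    define A' where "A' = {t. y + t *\<^sub>R \<e> j \<in> Q'}"
    define \<phi> where "\<phi> s = coord (f (proj ?I (y + s *\<^sub>R \<e> i))) j" for s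
    define \<phi>' where "\<phi>' s = coord (D (y + s *\<^sub>R \<e> i) (\<e> i)) j" for s
    define pt where "pt s = ?g (y + s *\<^sub>R \<e> i)" for s
    have line_m: "(\<lambda>s. y + s *\<^sub>R \<e> k) \<in> borel_measurable borel" for k
      by (intro borel_measurable_continuous_onI continuous_intros)
    have yJ: "coord y k = 0" if "k \<notin> J" for k using y that by (auto simp: subspace_of_eq)
    have sub: "proj ?I (y + s *\<^sub>R \<e> i) = y + s *\<^sub>R \<e> i" "proj ?I' (y + s *\<^sub>R \<e> j) = y + s *\<^sub>R \<e> j" for s
      using yJ by (auto intro!: ell2_eqI simp: coord_proj coord_unit)
    have ptE: "pt s \<in> E" "pt s \<in> S \<inter> U" "pt s \<in> S \<inter> U'" "y + s *\<^sub>R \<e> i \<in> G" if "s \<in> A" for s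
      using that E(1) by (auto simp: A_def QE pt_def)
    have pt_coord: "coord (pt s) i = s" "coord (pt s) j = \<phi> s"
      "proj ?I (pt s) = y + s *\<^sub>R \<e> i" "proj ?I' (pt s) = y + \<phi> s *\<^sub>R \<e> j" if s: "s \<in> A" for s
    proof -
      show pI: "proj ?I (pt s) = y + s *\<^sub>R \<e> i"
        using proj_graph_map[OF c ptE(4)[OF s]] sub by (simp add: pt_def)
      have pc: "coord (pt s) k = coord (y + s *\<^sub>R \<e> i) k" if "k \<in> ?I" for k
        using arg_cong[OF pI, of "\<lambda>z. coord z k"] that by (simp add: coord_proj)
      show "coord (pt s) i = s" using pc[of i] ij yJ by (simp add: coord_unit)
      show pj: "coord (pt s) j = \<phi> s"
        using ij yJ[of j] by (simp add: pt_def graph_map_def sub \<phi>_def coord_unit)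
      show "proj ?I' (pt s) = y + \<phi> s *\<^sub>R \<e> j"
      proof (rule ell2_eqI)
        fix k show "coord (proj ?I' (pt s)) k = coord (y + \<phi> s *\<^sub>R \<e> j) k"
          using pc[of k] pj ij yJ[of k] by (auto simp: coord_proj coord_unit)
      qed
    qed
    have g'_pt: "y + \<phi> s *\<^sub>R \<e> j \<in> G'" "?g' (y + \<phi> s *\<^sub>R \<e> j) = pt s" if s: "s \<in> A" for s
      using chart_point[OF c' ptE(3)[OF s]] chart_saturated[OF c', of "pt s"]
        graph_map_proj[OF c', of "pt s"] pt_coord(4)[OF s] by auto
    have img: "\<phi> ` A = A'"
    proof safe
      fix s assume s: "s \<in> A"
      show "\<phi> s \<in> A'" using g'_pt[OF s] ptE(1)[OF s] by (simp add: A'_def QE')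
    next
      fix t assume t: "t \<in> A'"
      define p where "p = ?g' (y + t *\<^sub>R \<e> j)"
      have p: "p \<in> E" "p \<in> S \<inter> U" "y + t *\<^sub>R \<e> j \<in> G'" using t E(1) by (auto simp: A'_def QE' p_def)
      have pI': "proj ?I' p = y + t *\<^sub>R \<e> j"
        using proj_graph_map[OF c' p(3)] sub by (simp add: p_def)
      have pc: "coord p k = coord (y + t *\<^sub>R \<e> j) k" if "k \<in> ?I'" for k
        using arg_cong[OF pI', of "\<lambda>z. coord z k"] that by (simp add: coord_proj)
      have pI: "proj ?I p = y + coord p i *\<^sub>R \<e> i"
      proof (rule ell2_eqI)
        fix k show "coord (proj ?I p) k = coord (y + coord p i *\<^sub>R \<e> i) k"
          using pc[of k] ij yJ[of k] by (auto simp: coord_proj coord_unit)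
      qed
      have gp: "?g (y + coord p i *\<^sub>R \<e> i) = p" "y + coord p i *\<^sub>R \<e> i \<in> G"
        using chart_point[OF c p(2)] chart_saturated[OF c, of p] graph_map_proj[OF c, of p] pI by auto
      then have s: "coord p i \<in> A" using p by (simp add: A_def QE)
      have "\<phi> (coord p i) = coord p j" using pt_coord(2)[OF s] gp by (simp add: pt_def)
      also have "\<dots> = t" using pc[of j] ij yJ by (simp add: coord_unit)
      finally show "t \<in> \<phi> ` A" using s by (metis imageI)
    qed
    have inj: "inj_on \<phi> A"
      by (rule inj_onI) (metis g'_pt(2) pt_coord(1))
    have Am: "A \<in> sets borel" and Am': "A' \<in> sets borel"
      using measurable_sets[OF line_m Qm] measurable_sets[OF line_m Qm']
      by (simp_all add: A_def A'_def vimage_def)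
    have der: "(\<phi> has_real_derivative \<phi>' s) (at s within A)" if s: "s \<in> A" for s
    proof -
      have "((\<lambda>r. coord (f (proj ?I ((y + s *\<^sub>R \<e> i) + r *\<^sub>R \<e> i))) j) has_real_derivative \<phi>' s) (at 0)"
        unfolding \<phi>'_def by (rule chart_coord_derivative_line[OF c ptE(4)[OF s]]) simp
      moreover have "(\<lambda>r. coord (f (proj ?I ((y + s *\<^sub>R \<e> i) + r *\<^sub>R \<e> i))) j) = (\<lambda>r. \<phi> (r + s))"
        by (auto simp: \<phi>_def algebra_simps)
      ultimately have "((\<lambda>r. \<phi> (r + s)) has_real_derivative \<phi>' s) (at 0)" by simp
      then have "(\<phi> has_real_derivative \<phi>' s) (at s)" using DERIV_shift[of \<phi> "\<phi>' s" 0 s] by simp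
      then show ?thesis by (rule has_field_derivative_at_within)
    qed
    have dm: "\<phi>' \<in> borel_measurable (restrict_space borel A)"
      unfolding \<phi>'_def[abs_def]
      by (intro borel_measurable_continuous_on_restrict continuous_intros
          continuous_on_compose2[OF chart_derivative_continuous[OF c]])
        (use ptE in auto)
    have wt: "?N i s * w (y + s *\<^sub>R \<e> i) = ennreal \<bar>\<phi>' s\<bar> * (?N j (\<phi> s) * w' (y + \<phi> s *\<^sub>R \<e> j))"
      if s: "s \<in> A" for s
    proof -
      have "\<phi> s \<in> A'" using img s by blast
      then have ind: "indicator Q (y + s *\<^sub>R \<e> i) = (1 :: ennreal)" "indicator Q' (y + \<phi> s *\<^sub>R \<e> j) = (1 :: ennreal)"
        using s by (simp_all add: A_def A'_def)
      have "D (pt s) (\<e> i) = D (proj ?I (pt s)) (proj ?I (\<e> i))"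
        using chart_derivative_proj[OF c chart_point(1)[OF c ptE(2)[OF s]]] by simp
      also have "\<dots> = D (y + s *\<^sub>R \<e> i) (\<e> i)" by (simp add: pt_coord(3)[OF s] proj_unit)
      finally have n: "n_factor ?I f (pt s) = ennreal \<bar>\<phi>' s\<bar> * n_factor ?I' f' (pt s)"
        using n_factor_swap[OF c c' ij ptE(2)[OF s] ptE(3)[OF s]] by (simp add: \<phi>'_def)
      \<comment> \<open>Both sides contain the product of the normal densities of all coordinates outside \<open>J\<close>.\<close>
      have "- ?I = insert j ?R" "- ?I' = insert i ?R" using ij by auto
      then have "density_prod a (- ?I) (pt s) = density_prod a ?R (pt s) * ?N j (\<phi> s)"
        "density_prod a (- ?I') (pt s) = density_prod a ?R (pt s) * ?N i s"
        using density_prod_insert[of a j ?R "pt s"] density_prod_insert[of a i ?R "pt s"] a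
          pt_coord(1,2)[OF s] by simp_all
      then show ?thesis
        by (simp add: w_def w'_def ind weight_def g'_pt(2)[OF s] pt_def[symmetric] n mult_ac)
    qed
    have "(\<integral>\<^sup>+ s. ?N i s * w (y + s *\<^sub>R \<e> i) \<partial>lborel)
        = (\<integral>\<^sup>+ s. ennreal \<bar>\<phi>' s\<bar> * (?N j (\<phi> s) * w' (y + \<phi> s *\<^sub>R \<e> j)) * indicator A s \<partial>lborel)"
    proof (rule nn_integral_cong)
      fix s
      show "?N i s * w (y + s *\<^sub>R \<e> i)
          = ennreal \<bar>\<phi>' s\<bar> * (?N j (\<phi> s) * w' (y + \<phi> s *\<^sub>R \<e> j)) * indicator A s"
        using wt[of s] by (cases "s \<in> A") (simp_all add: A_def w_def)
    qed
    also have "\<dots> = (\<integral>\<^sup>+ t. ?N j t * w' (y + t *\<^sub>R \<e> j) * indicator (\<phi> ` A) t \<partial>lborel)"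
    proof (rule nn_integral_image_real[OF Am der inj _ dm, symmetric])
      show "\<phi> ` A \<in> sets borel" using Am' img by simp
      show "(\<lambda>t. ?N j t * w' (y + t *\<^sub>R \<e> j)) \<in> borel_measurable borel"
        by (intro borel_measurable_times_ennreal measurable_compose[OF line_m w']) simp
    qed
    also have "\<dots> = (\<integral>\<^sup>+ t. ?N j t * w' (y + t *\<^sub>R \<e> j) \<partial>lborel)"
      unfolding img by (intro nn_integral_cong) (auto simp: A'_def w'_def indicator_def)
    finally show ?thesis .
  qed
  show ?thesis
    unfolding sc sc' nn_integral_gauss_measure_insert[OF a ij(1) w] nn_integral_gauss_measure_insert[OF a ij(2) w']
    by (rule nn_integral_cong) (simp add: space_gauss_measure inner)
qed


text \<open>
  The values of \<open>f\<close> are determined by the points of the surface, and its partial derivatives by the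
  tangent vectors.
\<close>

lemma surface_content_same_index:
  assumes a: "\<And>i. a i > 0"
    and c: "chart S U I f G D" and c': "chart S U' I f' G' D'"
    and E: "E \<subseteq> S \<inter> U" "E \<subseteq> S \<inter> U'"
  shows "surface_content a I f E = surface_content a I f' E"
proof -
  have "n_factor I f (x + f x) * F_density a (- I) (f x) * indicator (proj I ` E) x
      = n_factor I f' (x + f' x) * F_density a (- I) (f' x) * indicator (proj I ` E) x" for x
  proof (cases "x \<in> proj I ` E")
    case True
    then obtain p where p: "p \<in> E" "x = proj I p" by blast
    have pS: "p \<in> S \<inter> U" "p \<in> S \<inter> U'" using p E by auto
    have pG: "p \<in> G" "graph_map I f p = p" "p \<in> G'" "graph_map I f' p = p"
      using chart_point[OF c pS(1)] chart_point[OF c' pS(2)] by auto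
    then have sum: "x + f x = p" "x + f' x = p" by (auto simp: graph_map_def p)
    have D: "D p (\<e> k) = D' p (\<e> k)" if k: "k \<in> I" for k
    proof -
      have "proj I (D p (\<e> k)) = 0"
        by (rule ell2_eqI) (simp add: coord_proj coord_chart_derivative[OF c pG(1)])
      then have "D' p (\<e> k + D p (\<e> k)) = D' p (\<e> k)"
        using chart_derivative_proj_arg[OF c' pG(3), of "\<e> k + D p (\<e> k)"] k
        by (simp add: proj_add proj_unit)
      then show ?thesis
        using chart_overlap_tangent[OF c c' pG(1,2), of "\<e> k"] pS k \<open>proj I (D p (\<e> k)) = 0\<close>
        by (simp add: proj_add proj_unit)
    qed
    have "minor_of (tangent_coord (D p)) (I - L) (L - I) = minor_of (tangent_coord (D' p)) (I - L) (L - I)"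
      if "L \<in> finite_swaps I" for L
      by (rule minor_of_cong) (use that D in \<open>auto simp: tangent_coord_def finite_swaps_def\<close>)
    then have "n_factor I f p = n_factor I f' p"
      unfolding n_factor_eq[OF c pG(1), unfolded pG(2)] n_factor_eq[OF c' pG(3), unfolded pG(4)]
      by (intro arg_cong[where f = ennreal_sqrt] infsum_cong) simp
    moreover have "f x = f' x" using sum by (metis add_left_cancel)
    ultimately show ?thesis using sum by simp
  qed simp
  then show ?thesis unfolding surface_content_def by simp
qed

text \<open>
  Induction on the number of indices that have to be exchanged.  The chart produced by \<open>chart_exchange\<close>
  lives near \<open>p\<close> only, hence the restriction to a neighbourhood \<open>W\<close>.
\<close>

lemma surface_content_locally_consistent:
  assumes a: "\<And>i. a i > 0"
    and "chart S U I f G D" "chart S U' I' f' G' D'" "I' \<in> finite_swaps I" "p \<in> S \<inter> U \<inter> U'"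
  shows "\<exists>W. open W \<and> p \<in> W \<and> (\<forall>B\<in>sets borel.
    surface_content a I f (B \<inter> W \<inter> (S \<inter> U \<inter> U')) = surface_content a I' f' (B \<inter> W \<inter> (S \<inter> U \<inter> U')))"
  using assms(2-)
proof (induction "card (I - I')" arbitrary: I U f G D)
  case 0
  note c = 0(2) and c' = 0(3)
  have "I = I'" using 0(1,4) by (auto simp: finite_swaps_def)
  then have c'': "chart S U I' f G D" using c by simp
  have "surface_content a I' f (B \<inter> (S \<inter> U \<inter> U')) = surface_content a I' f' (B \<inter> (S \<inter> U \<inter> U'))" for B
    by (rule surface_content_same_index[OF a c'' c']) auto
  then show ?case using \<open>I = I'\<close> by (intro exI[of _ UNIV]) simp
next
  case (Suc n)
  note c = Suc.prems(1) and c' = Suc.prems(2)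
  obtain i where i: "i \<in> I" "i \<notin> I'" using Suc(2) by (metis Diff_iff card.empty ex_in_conv nat.distinct(1))
  define J where "J = I - {i}"
  have IJ: "I = insert i J" "i \<notin> J" using i by (auto simp: J_def)
  have pS: "p \<in> S \<inter> U" "p \<in> S \<inter> U'" using Suc.prems(4) by auto
  have pG: "p \<in> G" "graph_map I f p = p" "p \<in> G'"
    using chart_point[OF c pS(1)] chart_point[OF c' pS(2)] by auto
  let ?t = "\<e> i + D p (\<e> i)"
  \<comment> \<open>A tangent vector of the second chart is determined by its coordinates in \<open>I'\<close>.\<close>
  have "\<exists>j. j \<in> I' - I \<and> coord (D p (\<e> i)) j \<noteq> 0"
  proof (rule ccontr)
    assume no: "\<not> ?thesis"
    have "proj I' ?t = 0"
    proof (rule ell2_eqI)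
      fix k
      have "coord (D p (\<e> i)) k = 0" if "k \<in> I'"
        using no that coord_chart_derivative[OF c pG(1), of k] by (cases "k \<in> I") auto
      then show "coord (proj I' ?t) k = coord 0 k" using i by (auto simp: coord_proj coord_unit)
    qed
    then have "?t = 0"
      using chart_overlap_tangent[OF c c' pG(1,2), of "\<e> i"] pS(2) i
        chart_derivative_proj_arg[OF c' pG(3), of ?t]
      by (simp add: proj_unit)
    moreover have "coord ?t i = 1"
      using coord_chart_derivative[OF c pG(1) i(1)] by (simp add: coord_unit)
    ultimately show False by simp
  qed
  then obtain j where j: "j \<in> I'" "j \<notin> I" "coord (D p (\<e> i)) j \<noteq> 0" by auto
  let ?K = "insert j J"
  have jJ: "j \<notin> J" "i \<noteq> j" using j IJ by auto
  obtain V h H Q where V: "chart S V ?K h H Q" "p \<in> V"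
    using chart_exchange[OF c[unfolded IJ(1)] IJ(2) jJ pG(1) j(3)] pG(2) IJ(1) by metis
  have "?K - I' = (I - I') - {i}" using i j IJ by auto
  then have card: "n = card (?K - I')"
    using Suc(2) i by (metis DiffI card_Diff_singleton diff_Suc_1)
  have sw: "I' \<in> finite_swaps ?K"
    by (rule finite_swaps_trans[OF Suc.prems(3)]) (use finite_swaps_insert[OF IJ(2) jJ(1)] IJ(1) in simp)
  obtain W where W: "open W" "p \<in> W" and eq: "\<And>B. B \<in> sets borel \<Longrightarrow>
      surface_content a ?K h (B \<inter> W \<inter> (S \<inter> V \<inter> U')) = surface_content a I' f' (B \<inter> W \<inter> (S \<inter> V \<inter> U'))"
    using Suc.hyps(1)[OF card V(1) c' sw] V(2) pS by auto
  show ?case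
  proof (intro exI[of _ "W \<inter> V"] conjI ballI)
    fix B :: "ell2 set" assume B: "B \<in> sets borel"
    let ?E = "B \<inter> (W \<inter> V) \<inter> (S \<inter> U \<inter> U')"
    have op: "U \<in> sets borel" "U' \<in> sets borel" "W \<in> sets borel"
      using chart_open(1)[OF c] chart_open(1)[OF c'] W(1) by auto
    have "surface_content a (insert i J) f ?E = surface_content a ?K h ?E"
      by (rule surface_content_swap[OF a c[unfolded IJ(1)] V(1) IJ(2) jJ, of _ "B \<inter> W \<inter> U'"])
        (use B op in auto)
    also have "?E = (B \<inter> U) \<inter> W \<inter> (S \<inter> V \<inter> U')" by auto
    also have "surface_content a ?K h \<dots> = surface_content a I' f' \<dots>"
      by (rule eq) (use B op in auto)
    also have "(B \<inter> U) \<inter> W \<inter> (S \<inter> V \<inter> U') = ?E" by auto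
    finally show "surface_content a I f ?E = surface_content a I' f' ?E" using IJ(1) by simp
  qed (use W V(2) chart_open(1)[OF V(1)] in auto)
qed

text \<open>
  The Lindeloef property, in the form of a sequence.
\<close>

lemma countable_open_subcover:
  fixes \<F> :: "ell2 set set"
  assumes "\<And>W. W \<in> \<F> \<Longrightarrow> open W" "\<F> \<noteq> {}"
  obtains W :: "nat \<Rightarrow> ell2 set" where "\<And>n. W n \<in> \<F>" "(\<Union>n. W n) = \<Union>\<F>"
proof -
  obtain \<F>' where F: "\<F>' \<subseteq> \<F>" "countable \<F>'" "\<Union>\<F>' = \<Union>\<F>"
    using Lindelof[OF assms(1)] by blast
  obtain W0 where W0: "W0 \<in> \<F>" using assms(2) by blast
  have "countable (insert W0 \<F>')" using F by simp
  then have r: "range (from_nat_into (insert W0 \<F>')) = insert W0 \<F>'"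
    by (intro range_from_nat_into) auto
  show ?thesis
  proof
    fix n
    have "from_nat_into (insert W0 \<F>') n \<in> insert W0 \<F>'" by (rule from_nat_into) simp
    then show "from_nat_into (insert W0 \<F>') n \<in> \<F>" using F(1) W0 by auto
  next
    show "(\<Union>n. from_nat_into (insert W0 \<F>') n) = \<Union>\<F>" using r F W0 by auto
  qed
qed

lemma disjointed_measurable:
  fixes W :: "nat \<Rightarrow> ell2 set"
  assumes "\<And>n. open (W n)"
  shows "disjointed W n \<in> sets borel"
  using sets.range_disjointed_sets[of W borel] borel_open[OF assms] by blast

lemma surface_content_decompose:
  fixes W :: "nat \<Rightarrow> ell2 set"
  assumes a: "\<And>i. a i > 0" and c: "chart S U I f G D"
    and E: "E \<in> sets (restrict_space borel (S \<inter> U))"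
    and W: "\<And>n. open (W n)" "E \<subseteq> (\<Union>n. W n)"
  shows "surface_content a I f E = (\<Sum>n. surface_content a I f (disjointed W n \<inter> E))"
proof -
  have sub: "E \<subseteq> S \<inter> U" using sets.sets_into_space[OF E] by (simp add: space_restrict_space)
  have "E = (\<Union>n. disjointed W n \<inter> E)" using W(2) UN_disjointed_eq[of W] by auto
  moreover have "surface_content a I f (\<Union>n. disjointed W n \<inter> E)
      = (\<Sum>n. surface_content a I f (disjointed W n \<inter> E))"
  proof (rule surface_content_UN[OF c a])
    show "disjointed W n \<inter> E \<in> sets (restrict_space borel (S \<inter> U))" for n
      by (rule sets_restrict_subset[OF E disjointed_measurable[OF W(1)]]) (use sub in auto)
    show "disjoint_family (\<lambda>n. disjointed W n \<inter> E)"
      using disjoint_family_disjointed[of W] by (auto simp: disjoint_family_on_def)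
  qed
  ultimately show ?thesis by simp
qed

text \<open>
  Countably many of the neighbourhoods on which the charts agree cover the overlap.
\<close>

lemma surface_content_consistent:
  assumes a: "\<And>i. a i > 0" and c: "chart S U I f G D" and c': "chart S U' I' f' G' D'"
    and I: "I' \<in> finite_swaps I"
    and E: "E \<in> sets (restrict_space borel (S \<inter> U))" "E \<subseteq> U'"
  shows "surface_content a I f E = surface_content a I' f' E"
proof -
  let ?T = "S \<inter> U \<inter> U'"
  have sub: "E \<subseteq> S \<inter> U" using sets.sets_into_space[OF E(1)] by (simp add: space_restrict_space)
  obtain B where B: "B \<in> sets borel" "E = B \<inter> (S \<inter> U)" using E(1) by (rule restrict_Int_set)
  have EB: "E = B \<inter> ?T" using B(2) E(2) by auto
  have E': "E \<in> sets (restrict_space borel (S \<inter> U'))"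
  proof -
    have eq: "E = (B \<inter> U) \<inter> (S \<inter> U')" using EB by auto
    show ?thesis
      unfolding eq by (rule restrict_IntI) (use B(1) chart_open(1)[OF c] in auto)
  qed
  define good where "good W \<longleftrightarrow> open W \<and> (\<forall>B\<in>sets borel.
      surface_content a I f (B \<inter> W \<inter> ?T) = surface_content a I' f' (B \<inter> W \<inter> ?T))" for W
  have good_cover: "\<exists>W. good W \<and> p \<in> W" if "p \<in> ?T" for p
    using surface_content_locally_consistent[where a = a, OF a c c' I that]
    unfolding good_def by blast
  have "good {}"
    unfolding good_def Int_empty_left Int_empty_right surface_content_empty
    by (intro conjI open_empty ballI refl)
  then have "{W. good W} \<noteq> {}" by blast
  then obtain W :: "nat \<Rightarrow> ell2 set" where W: "\<And>n. W n \<in> {W. good W}" "(\<Union>n. W n) = \<Union>{W. good W}"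
    by (rule countable_open_subcover[rotated]) (auto simp: good_def)
  have oW: "open (W n)" for n using W(1)[of n] by (simp add: good_def)
  have cover: "E \<subseteq> (\<Union>n. W n)" using good_cover EB W(2) by auto
  have "surface_content a I f (disjointed W n \<inter> E) = surface_content a I' f' (disjointed W n \<inter> E)" for n
  proof -
    have "disjointed W n \<inter> E = (disjointed W n \<inter> B) \<inter> W n \<inter> ?T"
      using disjointed_subset[of W n] EB by auto
    moreover have "disjointed W n \<inter> B \<in> sets borel" using disjointed_measurable[OF oW] B by auto
    ultimately show ?thesis using W(1)[of n] by (auto simp: good_def)
  qed
  then show ?thesis
    using surface_content_decompose[where a = a, OF a c E(1) oW cover]
      surface_content_decompose[where a = a, OF a c' E' oW cover]
    by simp
qed

theorem proposition4p2:
  fixes a :: "nat \<Rightarrow> real" and I0 :: "nat set" and S :: "ell2 set"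
    and \<A> :: "(ell2 set \<times> nat set \<times> (ell2 \<Rightarrow> ell2)) set"
  assumes "\<And>i. a i > 0" and "summable a"
    and "I0 \<noteq> {}"
    and "C1_differentiable_surface I0 S \<A>"
  shows "\<exists>!\<mu> :: ell2 measure. sets \<mu> = sets (restrict_space borel S) \<and>
    (\<forall>V I f. local_coordinate_triple I0 S V I f \<longrightarrow>
      (\<forall>E\<in>sets (restrict_space borel V).
        emeasure \<mu> E =
          (\<integral>\<^sup>+ x\<in>proj I ` E. n_factor I f (x + f x) * F_density a (- I) (f x) \<partial>gauss_measure a I)))"
proof -
  let ?R = "restrict_space borel S"
  note a = assms(1)
  have surf: "surface_with_codim I0 S" using assms(4) by (simp add: C1_differentiable_surface_def)
  define piece where "piece U \<longleftrightarrow> (\<exists>I f G D. local_coordinate_triple I0 S (S \<inter> U) I f \<and> chart S U I f G D)" for U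
  have piece_cover: "\<exists>U. piece U \<and> x \<in> U" if x: "x \<in> S" for x
  proof -
    obtain V I f where V: "x \<in> V" "local_coordinate_triple I0 S V I f"
      using surf x unfolding surface_with_codim_def by blast
    obtain U G D where "V = S \<inter> U" "chart S U I f G D"
      using local_coordinate_triple_chart[OF V(2)] by blast
    then show ?thesis using V unfolding piece_def by blast
  qed
  have "S \<noteq> {}" using surf by (simp add: surface_with_codim_def)
  then have "{U. piece U} \<noteq> {}" using piece_cover by blast
  then obtain U :: "nat \<Rightarrow> ell2 set" where U: "\<And>n. U n \<in> {U. piece U}" "(\<Union>n. U n) = \<Union>{U. piece U}"
    by (rule countable_open_subcover[rotated]) (auto simp: piece_def dest: chart_open)
  have cover: "S \<subseteq> (\<Union>n. U n)" using U(2) piece_cover by auto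
  have "\<exists>I f G D. local_coordinate_triple I0 S (S \<inter> U n) I f \<and> chart S (U n) I f G D" for n
    using U(1)[of n] by (simp add: piece_def)
  then obtain I f G D where t: "\<And>n. local_coordinate_triple I0 S (S \<inter> U n) (I n) (f n)"
    and c: "\<And>n. chart S (U n) (I n) (f n) (G n) (D n)" by metis
  have In: "I n \<in> index_class I0" for n using t[of n] by (simp add: local_coordinate_triple_def)
  have oU: "open (U n)" for n using chart_open(1)[OF c] .
  \<comment> \<open>The surface measure adds up what the charts assign to the disjoint pieces \<open>?U n \<inter> S\<close>.\<close>
  let ?U = "disjointed U"
  have mU: "?U n \<in> sets borel" for n using disjointed_measurable[of U] oU by blast
  have dj: "disjoint_family (\<lambda>n. ?U n \<inter> E)" for E
    using disjoint_family_disjointed[of U] by (auto simp: disjoint_family_on_def)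
  have piece_meas: "?U n \<inter> E \<in> sets (restrict_space borel (S \<inter> U n))" if "E \<in> sets ?R" for n E
    by (rule sets_restrict_subset[OF that mU])
      (use disjointed_subset[of U n] sets.sets_into_space[OF that] in \<open>auto simp: space_restrict_space\<close>)
  have split: "E = (\<Union>n. ?U n \<inter> E)" if "E \<in> sets ?R" for E
    using sets.sets_into_space[OF that] cover UN_disjointed_eq[of U] by (auto simp: space_restrict_space)
  have in_R: "E \<in> sets ?R" if EW: "E \<in> sets (restrict_space borel (S \<inter> W))" "open W" for E W
  proof -
    obtain B where "B \<in> sets borel" "E = B \<inter> (S \<inter> W)" using EW(1) by (rule restrict_Int_set)
    then have eq: "E = (B \<inter> W) \<inter> S" and "B \<inter> W \<in> sets borel" using EW(2) by auto
    then show ?thesis unfolding eq by (intro restrict_IntI)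
  qed
  define m where "m E = (\<Sum>n. surface_content a (I n) (f n) (?U n \<inter> E))" for E
  have add: "countably_additive (sets ?R) m"
  proof (rule countably_additiveI)
    fix E :: "nat \<Rightarrow> ell2 set" assume E: "range E \<subseteq> sets ?R" "disjoint_family E"
    have "surface_content a (I n) (f n) (?U n \<inter> (\<Union>k. E k))
        = (\<Sum>k. surface_content a (I n) (f n) (?U n \<inter> E k))" for n
    proof -
      have "?U n \<inter> (\<Union>k. E k) = (\<Union>k. ?U n \<inter> E k)" by auto
      moreover have "surface_content a (I n) (f n) (\<Union>k. ?U n \<inter> E k)
          = (\<Sum>k. surface_content a (I n) (f n) (?U n \<inter> E k))"
        by (rule surface_content_UN[OF c a])
          (use E piece_meas in \<open>auto simp: disjoint_family_on_def\<close>)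
      ultimately show ?thesis by simp
    qed
    then have "m (\<Union>k. E k) = (\<integral>\<^sup>+ n. \<integral>\<^sup>+ k. surface_content a (I n) (f n) (?U n \<inter> E k)
        \<partial>count_space UNIV \<partial>count_space UNIV)"
      by (simp add: m_def nn_integral_count_space_nat)
    also have "\<dots> = (\<integral>\<^sup>+ k. \<integral>\<^sup>+ n. surface_content a (I n) (f n) (?U n \<inter> E k)
        \<partial>count_space UNIV \<partial>count_space UNIV)"
      by (rule pair_sigma_finite.Fubini')
        (auto intro!: pair_sigma_finite.intro sigma_finite_measure_count_space
           simp: pair_measure_countable)
    also have "\<dots> = (\<Sum>k. m (E k))"
      by (simp add: m_def nn_integral_count_space_nat)
    finally show "(\<Sum>k. m (E k)) = m (\<Union>k. E k)" ..
  qed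
  have pos: "positive (sets ?R) m" by (simp add: positive_def m_def surface_content_def)
  define \<mu> where "\<mu> = measure_of (space ?R) (sets ?R) m"
  have sets_mu: "sets \<mu> = sets ?R" unfolding \<mu>_def by (rule sets.sets_measure_of_eq)
  have em: "emeasure \<mu> E = m E" if "E \<in> sets ?R" for E
    unfolding \<mu>_def by (rule emeasure_measure_of_sigma[OF sets.sigma_algebra_axioms pos add that])
  have formula: "emeasure \<mu> E = surface_content a J g E"
    if J: "local_coordinate_triple I0 S V J g" and E: "E \<in> sets (restrict_space borel V)" for V J g E
  proof -
    obtain W H Q where W: "V = S \<inter> W" "chart S W J g H Q" using local_coordinate_triple_chart[OF J] by blast
    have oW: "open W" using chart_open(1)[OF W(2)] .
    have EW: "E \<in> sets (restrict_space borel (S \<inter> W))" using E W by simp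
    have subW: "E \<subseteq> S \<inter> W" using sets.sets_into_space[OF EW] by (simp add: space_restrict_space)
    have ER: "E \<in> sets ?R" by (rule in_R[OF EW oW])
    have "surface_content a (I n) (f n) (?U n \<inter> E) = surface_content a J g (?U n \<inter> E)" for n
    proof (rule surface_content_consistent[OF a c W(2) _ piece_meas[OF ER]])
      show "J \<in> finite_swaps (I n)"
        by (rule index_class_finite_swaps[OF In]) (use J in \<open>simp add: local_coordinate_triple_def\<close>)
    qed (use subW in auto)
    moreover have "surface_content a J g E = (\<Sum>n. surface_content a J g (?U n \<inter> E))"
      by (rule surface_content_decompose[OF a W(2) EW oU]) (use subW cover in auto)
    ultimately show ?thesis by (simp add: em[OF ER] m_def)
  qed
  show ?thesis
    unfolding surface_content_def[symmetric]
  proof (rule ex1I[of _ \<mu>])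
    show "sets \<mu> = sets ?R \<and> (\<forall>V J g. local_coordinate_triple I0 S V J g \<longrightarrow>
        (\<forall>E\<in>sets (restrict_space borel V). emeasure \<mu> E = surface_content a J g E))"
      using sets_mu formula by blast
  next
    fix \<nu> :: "ell2 measure"
    assume nu: "sets \<nu> = sets ?R \<and> (\<forall>V J g. local_coordinate_triple I0 S V J g \<longrightarrow>
        (\<forall>E\<in>sets (restrict_space borel V). emeasure \<nu> E = surface_content a J g E))"
    show "\<nu> = \<mu>"
    proof (rule measure_eqI)
      fix E assume "E \<in> sets \<nu>"
      then have E: "E \<in> sets ?R" using nu by simp
      have "?U n \<inter> E \<in> sets \<nu>" for n using in_R[OF piece_meas[OF E] oU] nu by simp
      then have "emeasure \<nu> (\<Union>n. ?U n \<inter> E) = (\<Sum>n. emeasure \<nu> (?U n \<inter> E))"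
        by (intro suminf_emeasure[symmetric] dj) auto
      also have "\<dots> = m E"
      proof -
        have "emeasure \<nu> (?U n \<inter> E) = surface_content a (I n) (f n) (?U n \<inter> E)" for n
          using nu t[of n] piece_meas[OF E, of n] by blast
        then show ?thesis by (simp only: m_def)
      qed
      finally show "emeasure \<nu> E = emeasure \<mu> E" using split[OF E] em[OF E] by simp
    qed (use nu sets_mu in simp)
  qed
qed

end
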